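(* Let $\mathbb{F}$ be a field with $\operatorname{char}(\mathbb{F})\neq 2$ and let $A$ be an algebra over $\mathbb{F}$ with the following property: for all $\mathbb{F}$-linear maps $f,g,h:A\to A$, if $f$ is a Jordan left $\{g,h\}$-derivation of $A$, then $f$ is a left $\{g,h\}$-derivation of $A$. Let $S$ be a commutative algebra over $\mathbb{F}$. Then the algebra $A\otimes S$ has the same property: for all $\mathbb{F}$-linear maps $f,g,h:A\otimes S\to A\otimes S$, if $f$ is a Jordan left $\{g,h\}$-derivation of $A\otimes S$, then $f$ is a left $\{g,h\}$-derivation of $A\otimes S$.
   Context: Algebras are associative. For an algebra $B$ over $\mathbb{F}$ and $\mathbb{F}$-linear maps $f,g,h:B\to B$: $f$ is a left $\{g,h\}$-derivation if $f(ab)=a\,g(b)+b\,h(a)=a\,h(b)+b\,g(a)$ for all $a,b\in B$; $f$ is a Jordan left $\{g,h\}$-derivation if $f(ab+ba)=2\big(a\,g(b)+b\,h(a)\big)$ for all $a,b\in B$. The tensor product $A\otimes S$ is over $\mathbb{F}$, with the usual multiplication $(x\otimes r)(y\otimes s)=xy\otimes rs$. *)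

theory Defs
  imports "HOL-Algebra.Module" "HOL-Algebra.QuotRing"
begin

text \<open>
  The library locale \<open>algebra\<close> is about commutative unital algebras only.  The algebras
  considered here are associative, but need be neither commutative nor unital: the field
  \<open>one\<close> of the record is unconstrained.
\<close>

locale assoc_algebra = module F B for F (structure) and B (structure) +
  assumes mult_closed: "\<lbrakk>x \<in> carrier B; y \<in> carrier B\<rbrakk> \<Longrightarrow> x \<otimes>\<^bsub>B\<^esub> y \<in> carrier B"
    and mult_assoc: "\<lbrakk>x \<in> carrier B; y \<in> carrier B; z \<in> carrier B\<rbrakk>
      \<Longrightarrow> (x \<otimes>\<^bsub>B\<^esub> y) \<otimes>\<^bsub>B\<^esub> z = x \<otimes>\<^bsub>B\<^esub> (y \<otimes>\<^bsub>B\<^esub> z)"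
    and add_mult: "\<lbrakk>x \<in> carrier B; y \<in> carrier B; z \<in> carrier B\<rbrakk>
      \<Longrightarrow> (x \<oplus>\<^bsub>B\<^esub> y) \<otimes>\<^bsub>B\<^esub> z = x \<otimes>\<^bsub>B\<^esub> z \<oplus>\<^bsub>B\<^esub> y \<otimes>\<^bsub>B\<^esub> z"
    and mult_add: "\<lbrakk>x \<in> carrier B; y \<in> carrier B; z \<in> carrier B\<rbrakk>
      \<Longrightarrow> x \<otimes>\<^bsub>B\<^esub> (y \<oplus>\<^bsub>B\<^esub> z) = x \<otimes>\<^bsub>B\<^esub> y \<oplus>\<^bsub>B\<^esub> x \<otimes>\<^bsub>B\<^esub> z"
    and smult_mult: "\<lbrakk>c \<in> carrier F; x \<in> carrier B; y \<in> carrier B\<rbrakk>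
      \<Longrightarrow> (c \<odot>\<^bsub>B\<^esub> x) \<otimes>\<^bsub>B\<^esub> y = c \<odot>\<^bsub>B\<^esub> (x \<otimes>\<^bsub>B\<^esub> y)"
    and mult_smult: "\<lbrakk>c \<in> carrier F; x \<in> carrier B; y \<in> carrier B\<rbrakk>
      \<Longrightarrow> x \<otimes>\<^bsub>B\<^esub> (c \<odot>\<^bsub>B\<^esub> y) = c \<odot>\<^bsub>B\<^esub> (x \<otimes>\<^bsub>B\<^esub> y)"

locale comm_assoc_algebra = assoc_algebra F B for F (structure) and B (structure) +
  assumes mult_comm: "\<lbrakk>x \<in> carrier B; y \<in> carrier B\<rbrakk> \<Longrightarrow> x \<otimes>\<^bsub>B\<^esub> y = y \<otimes>\<^bsub>B\<^esub> x"

definition ring_characteristic :: "('f, 'm) ring_scheme \<Rightarrow> nat" where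
  "ring_characteristic F =
    (if \<exists>n>0::nat. add_pow F n \<one>\<^bsub>F\<^esub> = \<zero>\<^bsub>F\<^esub>
     then LEAST n::nat. n > 0 \<and> add_pow F n \<one>\<^bsub>F\<^esub> = \<zero>\<^bsub>F\<^esub> else 0)"

definition linear_endo ::
  "('f, 'm) ring_scheme \<Rightarrow> ('f, 'b, 'n) module_scheme \<Rightarrow> ('b \<Rightarrow> 'b) \<Rightarrow> bool" where
  "linear_endo F B f \<longleftrightarrow>
    f \<in> carrier B \<rightarrow> carrier B \<and>
    (\<forall>x\<in>carrier B. \<forall>y\<in>carrier B. f (x \<oplus>\<^bsub>B\<^esub> y) = f x \<oplus>\<^bsub>B\<^esub> f y) \<and>
    (\<forall>c\<in>carrier F. \<forall>x\<in>carrier B. f (c \<odot>\<^bsub>B\<^esub> x) = c \<odot>\<^bsub>B\<^esub> f x)"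

text \<open>
  In the next two definitions the map that is the (Jordan) left {g,h}-derivation comes last,
  and linearity is not included.
\<close>

definition left_gh_derivation ::
  "('b, 'n) ring_scheme \<Rightarrow> ('b \<Rightarrow> 'b) \<Rightarrow> ('b \<Rightarrow> 'b) \<Rightarrow> ('b \<Rightarrow> 'b) \<Rightarrow> bool" where
  "left_gh_derivation B g h f \<longleftrightarrow>
    (\<forall>a\<in>carrier B. \<forall>b\<in>carrier B.
      f (a \<otimes>\<^bsub>B\<^esub> b) = a \<otimes>\<^bsub>B\<^esub> g b \<oplus>\<^bsub>B\<^esub> b \<otimes>\<^bsub>B\<^esub> h a \<and>
      f (a \<otimes>\<^bsub>B\<^esub> b) = a \<otimes>\<^bsub>B\<^esub> h b \<oplus>\<^bsub>B\<^esub> b \<otimes>\<^bsub>B\<^esub> g a)"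

definition jordan_left_gh_derivation ::
  "('b, 'n) ring_scheme \<Rightarrow> ('b \<Rightarrow> 'b) \<Rightarrow> ('b \<Rightarrow> 'b) \<Rightarrow> ('b \<Rightarrow> 'b) \<Rightarrow> bool" where
  "jordan_left_gh_derivation B g h f \<longleftrightarrow>
    (\<forall>a\<in>carrier B. \<forall>b\<in>carrier B.
      f (a \<otimes>\<^bsub>B\<^esub> b \<oplus>\<^bsub>B\<^esub> b \<otimes>\<^bsub>B\<^esub> a) = add_pow B (2::nat) (a \<otimes>\<^bsub>B\<^esub> g b \<oplus>\<^bsub>B\<^esub> b \<otimes>\<^bsub>B\<^esub> h a))"

definition jordan_left_gh_derivations_are_left ::
  "('f, 'm) ring_scheme \<Rightarrow> ('f, 'b, 'n) module_scheme \<Rightarrow> bool" where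
  "jordan_left_gh_derivations_are_left F B \<longleftrightarrow>
    (\<forall>f g h. linear_endo F B f \<and> linear_endo F B g \<and> linear_endo F B h \<and>
      jordan_left_gh_derivation B g h f \<longrightarrow> left_gh_derivation B g h f)"

text \<open>
  The tensor product is the usual quotient of the free module on the pairs
  \<open>(x, r) \<in> carrier A \<times> carrier S\<close> by the submodule generated by the bilinearity relations.
  Elements of the free module are the finitely supported functions, zero off
  \<open>carrier A \<times> carrier S\<close>.  Its product is the bilinear extension of
  \<open>(x, r) \<cdot> (y, s) = (x y, r s)\<close>, which descends to the quotient.
\<close>

definition free_pairs ::
  "('f, 'm) ring_scheme \<Rightarrow> ('a, 'u) ring_scheme \<Rightarrow> ('s, 'v) ring_scheme
    \<Rightarrow> ('a \<times> 's \<Rightarrow> 'f) set" where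
  "free_pairs F A S =
    {p. range p \<subseteq> carrier F \<and> finite {u. p u \<noteq> \<zero>\<^bsub>F\<^esub>} \<and>
        {u. p u \<noteq> \<zero>\<^bsub>F\<^esub>} \<subseteq> carrier A \<times> carrier S}"

definition pair_delta :: "('f, 'm) ring_scheme \<Rightarrow> 'a \<Rightarrow> 's \<Rightarrow> 'a \<times> 's \<Rightarrow> 'f" where
  "pair_delta F x r = (\<lambda>u. if u = (x, r) then \<one>\<^bsub>F\<^esub> else \<zero>\<^bsub>F\<^esub>)"

definition free_pair_algebra ::
  "('f, 'm) ring_scheme \<Rightarrow> ('a, 'u) ring_scheme \<Rightarrow> ('s, 'v) ring_scheme
    \<Rightarrow> ('f, 'a \<times> 's \<Rightarrow> 'f) module" where
  "free_pair_algebra F A S =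
    \<lparr> carrier = free_pairs F A S,
      mult = (\<lambda>p q w. \<Oplus>\<^bsub>F\<^esub>u\<in>{u. p u \<noteq> \<zero>\<^bsub>F\<^esub>}. \<Oplus>\<^bsub>F\<^esub>v\<in>{v. q v \<noteq> \<zero>\<^bsub>F\<^esub>}.
        (if (fst u \<otimes>\<^bsub>A\<^esub> fst v, snd u \<otimes>\<^bsub>S\<^esub> snd v) = w then p u \<otimes>\<^bsub>F\<^esub> q v else \<zero>\<^bsub>F\<^esub>)),
      one = pair_delta F \<one>\<^bsub>A\<^esub> \<one>\<^bsub>S\<^esub>,
      zero = (\<lambda>_. \<zero>\<^bsub>F\<^esub>),
      add = (\<lambda>p q w. p w \<oplus>\<^bsub>F\<^esub> q w),
      smult = (\<lambda>c p w. c \<otimes>\<^bsub>F\<^esub> p w) \<rparr>"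

definition tensor_relators ::
  "('f, 'm) ring_scheme \<Rightarrow> ('f, 'a, 'u) module_scheme \<Rightarrow> ('f, 's, 'v) module_scheme
    \<Rightarrow> ('a \<times> 's \<Rightarrow> 'f) set" where
  "tensor_relators F A S =
    (let M = free_pair_algebra F A S; \<delta> = pair_delta F in
      {\<delta> (x \<oplus>\<^bsub>A\<^esub> y) r \<ominus>\<^bsub>M\<^esub> (\<delta> x r \<oplus>\<^bsub>M\<^esub> \<delta> y r) |x y r.
        x \<in> carrier A \<and> y \<in> carrier A \<and> r \<in> carrier S} \<union>
      {\<delta> x (r \<oplus>\<^bsub>S\<^esub> s) \<ominus>\<^bsub>M\<^esub> (\<delta> x r \<oplus>\<^bsub>M\<^esub> \<delta> x s) |x r s.
        x \<in> carrier A \<and> r \<in> carrier S \<and> s \<in> carrier S} \<union>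
      {\<delta> (c \<odot>\<^bsub>A\<^esub> x) r \<ominus>\<^bsub>M\<^esub> c \<odot>\<^bsub>M\<^esub> \<delta> x r |c x r.
        c \<in> carrier F \<and> x \<in> carrier A \<and> r \<in> carrier S} \<union>
      {\<delta> x (c \<odot>\<^bsub>S\<^esub> r) \<ominus>\<^bsub>M\<^esub> c \<odot>\<^bsub>M\<^esub> \<delta> x r |c x r.
        c \<in> carrier F \<and> x \<in> carrier A \<and> r \<in> carrier S})"

definition tensor_null ::
  "('f, 'm) ring_scheme \<Rightarrow> ('f, 'a, 'u) module_scheme \<Rightarrow> ('f, 's, 'v) module_scheme
    \<Rightarrow> ('a \<times> 's \<Rightarrow> 'f) set" where
  "tensor_null F A S =
    \<Inter>{N. submodule N F (free_pair_algebra F A S) \<and> tensor_relators F A S \<subseteq> N}"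

text \<open>
  The carrier consists of the cosets of \<open>tensor_null F A S\<close>; apart from scalar multiplication
  this is the library's quotient \<open>FactRing\<close>.
\<close>

definition tensor_algebra ::
  "('f, 'm) ring_scheme \<Rightarrow> ('f, 'a, 'u) module_scheme \<Rightarrow> ('f, 's, 'v) module_scheme
    \<Rightarrow> ('f, ('a \<times> 's \<Rightarrow> 'f) set) module" where
  "tensor_algebra F A S =
    (let M = free_pair_algebra F A S; N = tensor_null F A S in
      ring.extend (M Quot N) \<lparr> smult = (\<lambda>c X. \<Union>p\<in>X. N +>\<^bsub>M\<^esub> (c \<odot>\<^bsub>M\<^esub> p)) \<rparr>)"

end

theory Submission
  imports Defs
begin

text \<open>
  Every linear form \<open>\<phi>\<close> on \<open>S\<close> gives a slice map \<open>id \<otimes> \<phi> : A \<otimes> S \<rightarrow> A\<close>, and over a field these maps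
  separate the points of \<open>A \<otimes> S\<close>: in a shortest representation of an element as a sum of pure
  tensors some form isolates any one of the summands.  For fixed \<open>r\<close> and \<open>s\<close> in \<open>S\<close> the map
  \<open>a \<mapsto> (id \<otimes> \<phi>) (f (a \<otimes> r s))\<close> is a Jordan left \<open>{g', h'}\<close>-derivation of \<open>A\<close>, where
  \<open>g' b = (id \<otimes> \<phi> (r \<cdot>)) (g (b \<otimes> s))\<close> and \<open>h' a = (id \<otimes> \<phi> (s \<cdot>)) (h (a \<otimes> r))\<close>.  Applying the
  hypothesis on \<open>A\<close> for every \<open>\<phi>\<close> gives the two identities on pure tensors, and both sides are
  biadditive.
\<close>

subsection \<open>Separating linear forms\<close>

text \<open>The values \<open>g (tens b s)\<close> and \<open>h (tens a r)\<close> need not be pure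
  tensors, so nothing known about \<open>A\<close> applies to them directly; slicing brings them
  into \<open>A\<close>. The factor on their left is pulled out by (id \<otimes> \<phi>)((a
  \<otimes> r) x) = a (id \<otimes> \<phi>(r \<cdot>))(x), which is why the forms in g' and h' are
  translated by r and s. The Jordan identity on \<open>A\<close> is the one on the tensor product at
  the pair a \<otimes> r, b \<otimes> s: commutativity of \<open>S\<close> gives (a \<otimes> r)(b
  \<otimes> s) + (b \<otimes> s)(a \<otimes> r) = (ab + ba) \<otimes> rs. In g' the element s sits
  inside and r in the form, in h' it is the other way round. Exchanging g' and h' therefore produces
  the values h (b \<otimes> r) and g (a \<otimes> s), and an exchange of r and s is needed to
  recover the second identity for a \<otimes> r and b \<otimes> s. The algebra \<open>S\<close> may
  have infinite dimension, so the separating forms come from Zorn's lemma.\<close>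

definition linear_form ::
  "('f, 'm) ring_scheme \<Rightarrow> ('f, 'v, 'n) module_scheme \<Rightarrow> ('v \<Rightarrow> 'f) \<Rightarrow> bool" where
  "linear_form F V \<phi> \<longleftrightarrow>
    \<phi> \<in> carrier V \<rightarrow> carrier F \<and>
    (\<forall>x\<in>carrier V. \<forall>y\<in>carrier V. \<phi> (x \<oplus>\<^bsub>V\<^esub> y) = \<phi> x \<oplus>\<^bsub>F\<^esub> \<phi> y) \<and>
    (\<forall>c\<in>carrier F. \<forall>x\<in>carrier V. \<phi> (c \<odot>\<^bsub>V\<^esub> x) = c \<otimes>\<^bsub>F\<^esub> \<phi> x)"

definition adjoin_vector ::
  "('f, 'm) ring_scheme \<Rightarrow> ('f, 'v, 'n) module_scheme \<Rightarrow> 'v set \<Rightarrow> 'v \<Rightarrow> 'v set" where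
  "adjoin_vector F V W x = {w \<oplus>\<^bsub>V\<^esub> c \<odot>\<^bsub>V\<^esub> x |w c. w \<in> W \<and> c \<in> carrier F}"

context module
begin

lemma submodule_adjoin_vector:
  assumes W: "submodule W R M" and x: "x \<in> carrier M"
  shows "submodule (adjoin_vector R M W x) R M"
proof (rule submoduleI)
  note W' = submoduleE[OF W]
  have sub: "w \<in> carrier M" if "w \<in> W" for w using W'(1) that by blast
  have z: "\<zero>\<^bsub>M\<^esub> \<in> W" using subgroup.one_closed[OF submodule.axioms(1)[OF W]] by simp
  show "adjoin_vector R M W x \<subseteq> carrier M" using x sub by (auto simp: adjoin_vector_def)
  show "\<zero>\<^bsub>M\<^esub> \<in> adjoin_vector R M W x"
    unfolding adjoin_vector_def using z x
    by (auto intro!: exI[of _ "\<zero>\<^bsub>M\<^esub>"] exI[of _ \<zero>])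
  show "a \<oplus>\<^bsub>M\<^esub> b \<in> adjoin_vector R M W x"
    if "a \<in> adjoin_vector R M W x" "b \<in> adjoin_vector R M W x" for a b
  proof -
    from that obtain w c w' c' where *: "a = w \<oplus>\<^bsub>M\<^esub> c \<odot>\<^bsub>M\<^esub> x" "b = w' \<oplus>\<^bsub>M\<^esub> c' \<odot>\<^bsub>M\<^esub> x"
      "w \<in> W" "w' \<in> W" "c \<in> carrier R" "c' \<in> carrier R"
      by (auto simp: adjoin_vector_def)
    then have "a \<oplus>\<^bsub>M\<^esub> b = (w \<oplus>\<^bsub>M\<^esub> w') \<oplus>\<^bsub>M\<^esub> (c \<oplus> c') \<odot>\<^bsub>M\<^esub> x"
      using x sub by (simp add: smult_l_distr M.a_ac)
    then show ?thesis
      using * W'(5) unfolding adjoin_vector_def by blast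
  qed
  have sm: "k \<odot>\<^bsub>M\<^esub> a \<in> adjoin_vector R M W x"
    if "k \<in> carrier R" "a \<in> adjoin_vector R M W x" for k a
  proof -
    from that obtain w c where *: "a = w \<oplus>\<^bsub>M\<^esub> c \<odot>\<^bsub>M\<^esub> x" "w \<in> W" "c \<in> carrier R"
      by (auto simp: adjoin_vector_def)
    then have "k \<odot>\<^bsub>M\<^esub> a = k \<odot>\<^bsub>M\<^esub> w \<oplus>\<^bsub>M\<^esub> (k \<otimes> c) \<odot>\<^bsub>M\<^esub> x"
      using x sub that(1) by (simp add: smult_r_distr smult_assoc1)
    then show ?thesis
      using * W'(4) that(1) unfolding adjoin_vector_def by blast
  qed
  then show "k \<odot>\<^bsub>M\<^esub> a \<in> adjoin_vector R M W x"
    if "k \<in> carrier R" "a \<in> adjoin_vector R M W x" for k a using that by blast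
  show "\<ominus>\<^bsub>M\<^esub> a \<in> adjoin_vector R M W x" if a: "a \<in> adjoin_vector R M W x" for a
  proof -
    have "a \<in> carrier M" using a x sub by (auto simp: adjoin_vector_def)
    then have "(\<ominus> \<one>) \<odot>\<^bsub>M\<^esub> a = \<ominus>\<^bsub>M\<^esub> a" by (simp add: smult_l_minus)
    then show ?thesis using sm[of "\<ominus> \<one>", OF _ a] by simp
  qed
qed

text \<open>This supplies the upper bounds for Zorn's lemma. Comparability of the members matters
  only for sums, where both summands lie in the larger of two members; nonemptiness provides the
  zero vector.\<close>

lemma submodule_Union_chain:
  assumes ne: "\<C> \<noteq> {}" and ch: "subset.chain {W. submodule W R M} \<C>"
  shows "submodule (\<Union>\<C>) R M"
proof (rule submoduleI)
  have sm: "submodule W R M" if "W \<in> \<C>" for W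
    using ch that by (auto simp: subset.chain_def)
  note W = submoduleE[OF sm]
  show "\<Union>\<C> \<subseteq> carrier M" using W(1) by blast
  show "\<zero>\<^bsub>M\<^esub> \<in> \<Union>\<C>" using ne subgroup.one_closed[OF submodule.axioms(1)[OF sm]] by auto
  show "\<ominus>\<^bsub>M\<^esub> a \<in> \<Union>\<C>" if "a \<in> \<Union>\<C>" for a using that W(3) by blast
  show "c \<odot>\<^bsub>M\<^esub> a \<in> \<Union>\<C>" if "c \<in> carrier R" "a \<in> \<Union>\<C>" for c a using that W(4) by blast
  show "a \<oplus>\<^bsub>M\<^esub> b \<in> \<Union>\<C>" if ab: "a \<in> \<Union>\<C>" "b \<in> \<Union>\<C>" for a b
  proof -
    obtain X Y where XY: "X \<in> \<C>" "Y \<in> \<C>" "a \<in> X" "b \<in> Y" using ab by blast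
    then have "X \<subseteq> Y \<or> Y \<subseteq> X"
      using ch unfolding subset_chain_def by blast
    then show ?thesis using XY W(5)[of X a b] W(5)[of Y a b] by blast
  qed
qed

end

text \<open>The form is the coordinate along \<open>v\<close> modulo a maximal subspace avoiding \<open>v\<close>.\<close>

lemma exists_separating_linear_form:
  assumes F: "field F" and V: "module F V"
    and W0: "submodule W0 F V" and v: "v \<in> carrier V" "v \<notin> W0"
  shows "\<exists>\<phi>. linear_form F V \<phi> \<and> \<phi> v = \<one>\<^bsub>F\<^esub> \<and> (\<forall>w\<in>W0. \<phi> w = \<zero>\<^bsub>F\<^esub>)"
proof -
  interpret F: field F by fact
  interpret V: module F V by fact
  let ?P = "{W. submodule W F V \<and> W0 \<subseteq> W \<and> v \<notin> W}"
  have "\<exists>W\<in>?P. \<forall>X\<in>?P. W \<subseteq> X \<longrightarrow> X = W"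
  proof (rule subset_Zorn_nonempty)
    show "?P \<noteq> {}" using W0 v by blast
    fix \<C> assume ne: "\<C> \<noteq> {}" and ch: "subset.chain ?P \<C>"
    have "subset.chain {W. submodule W F V} \<C>" using ch by (auto simp: subset_chain_def)
    then have "submodule (\<Union>\<C>) F V" using V.submodule_Union_chain ne by blast
    then show "\<Union>\<C> \<in> ?P" using ne ch by (auto simp: subset_chain_def)
  qed
  then obtain W where "W \<in> ?P" and W_max: "\<forall>X\<in>?P. W \<subseteq> X \<longrightarrow> X = W" ..
  then have W: "submodule W F V" "W0 \<subseteq> W" "v \<notin> W" by simp_all
  have max: "X = W" if "submodule X F V" "W \<subseteq> X" "v \<notin> X" for X
    using W_max that W(2) by simp
  note W' = V.submoduleE[OF W(1)]
  have sub: "w \<in> carrier V" if "w \<in> W" for w using W'(1) that by blast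
  have z: "\<zero>\<^bsub>V\<^esub> \<in> W" using subgroup.one_closed[OF submodule.axioms(1)[OF W(1)]] by simp
  \<comment> \<open>Maximality gives V = W + F v. For \<open>x\<close> outside \<open>W\<close> the
    subspace W + F x is strictly larger than \<open>W\<close>, so it contains \<open>v\<close>; the
    coefficient of \<open>x\<close> in \<open>v\<close> is nonzero because \<open>v\<close> is not
    in \<open>W\<close>, and dividing by it solves for \<open>x\<close>.\<close>
  have ex: "\<exists>c\<in>carrier F. \<exists>w\<in>W. x = w \<oplus>\<^bsub>V\<^esub> c \<odot>\<^bsub>V\<^esub> v" if x: "x \<in> carrier V" for x
  proof (cases "x \<in> W")
    case True
    then show ?thesis using x v by (auto intro!: bexI[of _ "\<zero>\<^bsub>F\<^esub>"] bexI[of _ x])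
  next
    case False
    let ?X = "adjoin_vector F V W x"
    have "W \<subseteq> ?X"
    proof
      fix w assume w: "w \<in> W"
      then have "w = w \<oplus>\<^bsub>V\<^esub> \<zero>\<^bsub>F\<^esub> \<odot>\<^bsub>V\<^esub> x" using x sub by simp
      then show "w \<in> ?X" using w unfolding adjoin_vector_def by blast
    qed
    moreover have "x \<in> ?X"
    proof -
      have "x = \<zero>\<^bsub>V\<^esub> \<oplus>\<^bsub>V\<^esub> \<one>\<^bsub>F\<^esub> \<odot>\<^bsub>V\<^esub> x" using x by simp
      then show ?thesis using z unfolding adjoin_vector_def by blast
    qed
    ultimately have "v \<in> ?X"
      using max[OF V.submodule_adjoin_vector[OF W(1) x]] False by blast
    then obtain w c where wc: "v = w \<oplus>\<^bsub>V\<^esub> c \<odot>\<^bsub>V\<^esub> x" "w \<in> W" "c \<in> carrier F"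
      by (auto simp: adjoin_vector_def)
    have "c \<noteq> \<zero>\<^bsub>F\<^esub>" using wc W(3) x sub[OF wc(2)] by auto
    then have c: "inv\<^bsub>F\<^esub> c \<in> carrier F" "inv\<^bsub>F\<^esub> c \<otimes>\<^bsub>F\<^esub> c = \<one>\<^bsub>F\<^esub>"
      using wc(3) F.field_Units by auto
    let ?u = "inv\<^bsub>F\<^esub> c \<odot>\<^bsub>V\<^esub> w"
    have u: "?u \<in> W" "?u \<in> carrier V" using c wc W' sub by auto
    have "inv\<^bsub>F\<^esub> c \<odot>\<^bsub>V\<^esub> v = ?u \<oplus>\<^bsub>V\<^esub> x"
      using wc c x sub by (simp add: V.smult_r_distr V.smult_assoc1[symmetric])
    then have "x = (\<ominus>\<^bsub>V\<^esub> ?u) \<oplus>\<^bsub>V\<^esub> inv\<^bsub>F\<^esub> c \<odot>\<^bsub>V\<^esub> v"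
      using u x by (simp add: V.M.r_neg1)
    then show ?thesis using c u W'(3) by blast
  qed
  \<comment> \<open>The description is well defined because the coefficient along \<open>v\<close>
    is unique: two different coefficients c and d of one vector would put (d - c) v, and after
    division \<open>v\<close> itself, into \<open>W\<close>.\<close>
  define \<phi> where "\<phi> x = (THE c. c \<in> carrier F \<and> (\<exists>w\<in>W. x = w \<oplus>\<^bsub>V\<^esub> c \<odot>\<^bsub>V\<^esub> v))" for x
  have phi: "\<phi> x = c" if c: "c \<in> carrier F" and w: "w \<in> W" and x: "x = w \<oplus>\<^bsub>V\<^esub> c \<odot>\<^bsub>V\<^esub> v" for x w c
    unfolding \<phi>_def
  proof (rule the_equality)
    show "c \<in> carrier F \<and> (\<exists>w\<in>W. x = w \<oplus>\<^bsub>V\<^esub> c \<odot>\<^bsub>V\<^esub> v)" using that by blast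
    fix d assume "d \<in> carrier F \<and> (\<exists>w\<in>W. x = w \<oplus>\<^bsub>V\<^esub> d \<odot>\<^bsub>V\<^esub> v)"
    then obtain u where d: "d \<in> carrier F" and u: "u \<in> W" and x': "x = u \<oplus>\<^bsub>V\<^esub> d \<odot>\<^bsub>V\<^esub> v" by blast
    show "d = c"
    proof (rule ccontr)
      assume ne: "d \<noteq> c"
      define e where "e = d \<ominus>\<^bsub>F\<^esub> c"
      have e: "e \<in> carrier F" "e \<noteq> \<zero>\<^bsub>F\<^esub>"
        using ne c d F.minus_equality[of d "\<ominus>\<^bsub>F\<^esub> c"] by (auto simp: e_def a_minus_def)
      then have ei: "inv\<^bsub>F\<^esub> e \<in> carrier F" "inv\<^bsub>F\<^esub> e \<otimes>\<^bsub>F\<^esub> e = \<one>\<^bsub>F\<^esub>"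
        using F.field_Units by auto
      have "d = c \<oplus>\<^bsub>F\<^esub> e" using c d unfolding e_def a_minus_def
        by (metis F.add.inv_closed F.add.m_lcomm F.r_neg F.r_zero)
      then have "w \<oplus>\<^bsub>V\<^esub> c \<odot>\<^bsub>V\<^esub> v = (u \<oplus>\<^bsub>V\<^esub> e \<odot>\<^bsub>V\<^esub> v) \<oplus>\<^bsub>V\<^esub> c \<odot>\<^bsub>V\<^esub> v"
        using x x' v c e sub[OF u] by (simp add: V.smult_l_distr V.M.a_ac)
      then have "w = u \<oplus>\<^bsub>V\<^esub> e \<odot>\<^bsub>V\<^esub> v"
        using v c e sub[OF u] sub[OF w] by (simp add: V.M.add.right_cancel)
      then have "e \<odot>\<^bsub>V\<^esub> v = (\<ominus>\<^bsub>V\<^esub> u) \<oplus>\<^bsub>V\<^esub> w"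
        using v e sub[OF u] by (simp add: V.M.r_neg1)
      then have "e \<odot>\<^bsub>V\<^esub> v \<in> W" using W' u w by auto
      then have "inv\<^bsub>F\<^esub> e \<odot>\<^bsub>V\<^esub> (e \<odot>\<^bsub>V\<^esub> v) \<in> W" using W'(4) ei by blast
      then have "v \<in> W" using ei e v by (simp add: V.smult_assoc1[symmetric])
      then show False using W(3) by blast
    qed
  qed
  have dec: "\<phi> x \<in> carrier F \<and> (\<exists>w\<in>W. x = w \<oplus>\<^bsub>V\<^esub> \<phi> x \<odot>\<^bsub>V\<^esub> v)" if x: "x \<in> carrier V" for x
    using ex[OF x] phi by metis
  have "linear_form F V \<phi>"
    unfolding linear_form_def
  proof (intro conjI ballI)
    show "\<phi> \<in> carrier V \<rightarrow> carrier F" using dec by blast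
    fix x y assume x: "x \<in> carrier V" and y: "y \<in> carrier V"
    from dec[OF x] dec[OF y] obtain w u where *: "w \<in> W" "u \<in> W" "x = w \<oplus>\<^bsub>V\<^esub> \<phi> x \<odot>\<^bsub>V\<^esub> v"
      "y = u \<oplus>\<^bsub>V\<^esub> \<phi> y \<odot>\<^bsub>V\<^esub> v" "\<phi> x \<in> carrier F" "\<phi> y \<in> carrier F" by blast
    have "(w \<oplus>\<^bsub>V\<^esub> \<phi> x \<odot>\<^bsub>V\<^esub> v) \<oplus>\<^bsub>V\<^esub> (u \<oplus>\<^bsub>V\<^esub> \<phi> y \<odot>\<^bsub>V\<^esub> v)
        = (w \<oplus>\<^bsub>V\<^esub> u) \<oplus>\<^bsub>V\<^esub> (\<phi> x \<oplus>\<^bsub>F\<^esub> \<phi> y) \<odot>\<^bsub>V\<^esub> v"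
      using *(1,2,5,6) sub v by (simp add: V.smult_l_distr V.M.a_ac)
    then have "x \<oplus>\<^bsub>V\<^esub> y = (w \<oplus>\<^bsub>V\<^esub> u) \<oplus>\<^bsub>V\<^esub> (\<phi> x \<oplus>\<^bsub>F\<^esub> \<phi> y) \<odot>\<^bsub>V\<^esub> v"
      using *(3,4) by simp
    then show "\<phi> (x \<oplus>\<^bsub>V\<^esub> y) = \<phi> x \<oplus>\<^bsub>F\<^esub> \<phi> y"
      using * W'(5) by (intro phi) auto
  next
    fix c x assume c: "c \<in> carrier F" and x: "x \<in> carrier V"
    from dec[OF x] obtain w where *: "w \<in> W" "x = w \<oplus>\<^bsub>V\<^esub> \<phi> x \<odot>\<^bsub>V\<^esub> v" "\<phi> x \<in> carrier F" by blast
    have "c \<odot>\<^bsub>V\<^esub> (w \<oplus>\<^bsub>V\<^esub> \<phi> x \<odot>\<^bsub>V\<^esub> v) = c \<odot>\<^bsub>V\<^esub> w \<oplus>\<^bsub>V\<^esub> (c \<otimes>\<^bsub>F\<^esub> \<phi> x) \<odot>\<^bsub>V\<^esub> v"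
      using *(1,3) sub v c by (simp add: V.smult_r_distr V.smult_assoc1)
    then have "c \<odot>\<^bsub>V\<^esub> x = c \<odot>\<^bsub>V\<^esub> w \<oplus>\<^bsub>V\<^esub> (c \<otimes>\<^bsub>F\<^esub> \<phi> x) \<odot>\<^bsub>V\<^esub> v"
      using *(2) by simp
    then show "\<phi> (c \<odot>\<^bsub>V\<^esub> x) = c \<otimes>\<^bsub>F\<^esub> \<phi> x"
      using * c W'(4) by (intro phi) auto
  qed
  moreover have "\<phi> v = \<one>\<^bsub>F\<^esub>" using v z by (intro phi[of _ "\<zero>\<^bsub>V\<^esub>"]) auto
  moreover have "\<phi> w = \<zero>\<^bsub>F\<^esub>" if "w \<in> W0" for w
    using that W(2) v sub by (intro phi[of _ w]) auto
  ultimately show ?thesis by blast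
qed

section \<open>Linear maps between modules and spans of lists\<close>

definition linear_map ::
  "('f, 'm) ring_scheme \<Rightarrow> ('f, 'x, 'n) module_scheme \<Rightarrow> ('f, 'y, 'k) module_scheme
    \<Rightarrow> ('x \<Rightarrow> 'y) \<Rightarrow> bool" where
  "linear_map F X Y k \<longleftrightarrow>
    k \<in> carrier X \<rightarrow> carrier Y \<and>
    (\<forall>x\<in>carrier X. \<forall>y\<in>carrier X. k (x \<oplus>\<^bsub>X\<^esub> y) = k x \<oplus>\<^bsub>Y\<^esub> k y) \<and>
    (\<forall>c\<in>carrier F. \<forall>x\<in>carrier X. k (c \<odot>\<^bsub>X\<^esub> x) = c \<odot>\<^bsub>Y\<^esub> k x)"

lemma linear_endo_iff: "linear_endo F B f \<longleftrightarrow> linear_map F B B f"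
  by (simp add: linear_endo_def linear_map_def)

lemma linear_mapD:
  assumes "linear_map F X Y k"
  shows "x \<in> carrier X \<Longrightarrow> k x \<in> carrier Y"
    and "\<lbrakk>x \<in> carrier X; y \<in> carrier X\<rbrakk> \<Longrightarrow> k (x \<oplus>\<^bsub>X\<^esub> y) = k x \<oplus>\<^bsub>Y\<^esub> k y"
    and "\<lbrakk>c \<in> carrier F; x \<in> carrier X\<rbrakk> \<Longrightarrow> k (c \<odot>\<^bsub>X\<^esub> x) = c \<odot>\<^bsub>Y\<^esub> k x"
  using assms by (auto simp: linear_map_def)

lemma linear_map_zero:
  assumes "linear_map F X Y k" "module F X" "module F Y"
  shows "k \<zero>\<^bsub>X\<^esub> = \<zero>\<^bsub>Y\<^esub>"
proof -
  interpret X: module F X by fact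
  interpret Y: module F Y by fact
  have "k (\<zero>\<^bsub>F\<^esub> \<odot>\<^bsub>X\<^esub> \<zero>\<^bsub>X\<^esub>) = \<zero>\<^bsub>F\<^esub> \<odot>\<^bsub>Y\<^esub> k \<zero>\<^bsub>X\<^esub>"
    by (rule linear_mapD(3)[OF assms(1)]) auto
  then show ?thesis using linear_mapD(1)[OF assms(1)] by simp
qed

lemma linear_formD:
  assumes "linear_form F V \<phi>"
  shows "x \<in> carrier V \<Longrightarrow> \<phi> x \<in> carrier F"
    and "\<lbrakk>x \<in> carrier V; y \<in> carrier V\<rbrakk> \<Longrightarrow> \<phi> (x \<oplus>\<^bsub>V\<^esub> y) = \<phi> x \<oplus>\<^bsub>F\<^esub> \<phi> y"
    and "\<lbrakk>c \<in> carrier F; x \<in> carrier V\<rbrakk> \<Longrightarrow> \<phi> (c \<odot>\<^bsub>V\<^esub> x) = c \<otimes>\<^bsub>F\<^esub> \<phi> x"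
  using assms by (auto simp: linear_form_def)

text \<open>The recursion makes membership in the span of a nonempty list yield a coefficient of its
  head and a vector in the span of its tail. Inductions over a list of pure tensors can thus split a
  vector of the span along with the list.\<close>

primrec list_span ::
  "('f, 'm) ring_scheme \<Rightarrow> ('f, 'v, 'n) module_scheme \<Rightarrow> 'v list \<Rightarrow> 'v set" where
  "list_span F V [] = {\<zero>\<^bsub>V\<^esub>}"
| "list_span F V (x # xs) = adjoin_vector F V (list_span F V xs) x"

lemma (in module) submodule_list_span:
  "set xs \<subseteq> carrier M \<Longrightarrow> submodule (list_span R M xs) R M"
proof (induction xs)
  case Nil
  show ?case by (auto intro!: submoduleI)
qed (auto intro: submodule_adjoin_vector)

lemma (in module) list_span_mem:
  assumes "set xs \<subseteq> carrier M" "x \<in> set xs"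
  shows "x \<in> list_span R M xs"
  using assms
proof (induction xs)
  case (Cons y xs)
  have W: "submodule (list_span R M xs) R M" using Cons.prems by (intro submodule_list_span) auto
  note W' = submoduleE[OF W]
  show ?case
  proof (cases "x = y")
    case True
    have "\<zero>\<^bsub>M\<^esub> \<in> list_span R M xs" using subgroup.one_closed[OF submodule.axioms(1)[OF W]] by simp
    moreover have "x = \<zero>\<^bsub>M\<^esub> \<oplus>\<^bsub>M\<^esub> \<one> \<odot>\<^bsub>M\<^esub> y" using True Cons.prems by simp
    ultimately show ?thesis unfolding list_span.simps adjoin_vector_def by blast
  next
    case False
    then have "x \<in> list_span R M xs" using Cons by auto
    moreover have "x = x \<oplus>\<^bsub>M\<^esub> \<zero> \<odot>\<^bsub>M\<^esub> y" using Cons.prems by auto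
    ultimately show ?thesis unfolding list_span.simps adjoin_vector_def by blast
  qed
qed simp

lemma (in assoc_algebra) mult_zero [simp]:
  "x \<in> carrier B \<Longrightarrow> x \<otimes>\<^bsub>B\<^esub> \<zero>\<^bsub>B\<^esub> = \<zero>\<^bsub>B\<^esub>"
  using mult_smult[of "\<zero>" x "\<zero>\<^bsub>B\<^esub>"] mult_closed by simp

subsection \<open>Slices of a tensor product\<close>

text \<open>An interface to A \<otimes> S that hides the quotient. \<open>tens_induct\<close> says
  that the pure tensors generate \<open>T\<close> additively; scalars do not occur in it because
  they can be absorbed into a factor. \<open>slice_exists\<close> is the universal property
  restricted to the bilinear maps (a, s) \<mapsto> \<phi>(s) a, and it is what prevents
  \<open>T\<close> from being too small.\<close>

locale tensor_product =
  F: field F + A: assoc_algebra F A + S: comm_assoc_algebra F S + T: module F T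
  for F :: "('f, 'm) ring_scheme" and A :: "('f, 'a, 'u) module_scheme"
    and S :: "('f, 's, 'v) module_scheme" and T :: "('f, 't, 'w) module_scheme" +
  fixes tens :: "'a \<Rightarrow> 's \<Rightarrow> 't"
  assumes T_mult_closed [simp]:
    "\<lbrakk>x \<in> carrier T; y \<in> carrier T\<rbrakk> \<Longrightarrow> x \<otimes>\<^bsub>T\<^esub> y \<in> carrier T"
  and T_add_mult: "\<lbrakk>x \<in> carrier T; y \<in> carrier T; z \<in> carrier T\<rbrakk>
      \<Longrightarrow> (x \<oplus>\<^bsub>T\<^esub> y) \<otimes>\<^bsub>T\<^esub> z = x \<otimes>\<^bsub>T\<^esub> z \<oplus>\<^bsub>T\<^esub> y \<otimes>\<^bsub>T\<^esub> z"
  and T_mult_add: "\<lbrakk>x \<in> carrier T; y \<in> carrier T; z \<in> carrier T\<rbrakk>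
      \<Longrightarrow> x \<otimes>\<^bsub>T\<^esub> (y \<oplus>\<^bsub>T\<^esub> z) = x \<otimes>\<^bsub>T\<^esub> y \<oplus>\<^bsub>T\<^esub> x \<otimes>\<^bsub>T\<^esub> z"
  and tens_closed [simp]: "\<lbrakk>a \<in> carrier A; s \<in> carrier S\<rbrakk> \<Longrightarrow> tens a s \<in> carrier T"
  and tens_add_left: "\<lbrakk>a \<in> carrier A; b \<in> carrier A; s \<in> carrier S\<rbrakk>
      \<Longrightarrow> tens (a \<oplus>\<^bsub>A\<^esub> b) s = tens a s \<oplus>\<^bsub>T\<^esub> tens b s"
  and tens_add_right: "\<lbrakk>a \<in> carrier A; r \<in> carrier S; s \<in> carrier S\<rbrakk>
      \<Longrightarrow> tens a (r \<oplus>\<^bsub>S\<^esub> s) = tens a r \<oplus>\<^bsub>T\<^esub> tens a s"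
  and tens_smult_left: "\<lbrakk>c \<in> carrier F; a \<in> carrier A; s \<in> carrier S\<rbrakk>
      \<Longrightarrow> tens (c \<odot>\<^bsub>A\<^esub> a) s = c \<odot>\<^bsub>T\<^esub> tens a s"
  and tens_smult_right: "\<lbrakk>c \<in> carrier F; a \<in> carrier A; s \<in> carrier S\<rbrakk>
      \<Longrightarrow> tens a (c \<odot>\<^bsub>S\<^esub> s) = c \<odot>\<^bsub>T\<^esub> tens a s"
  and tens_mult: "\<lbrakk>a \<in> carrier A; b \<in> carrier A; r \<in> carrier S; s \<in> carrier S\<rbrakk>
      \<Longrightarrow> tens a r \<otimes>\<^bsub>T\<^esub> tens b s = tens (a \<otimes>\<^bsub>A\<^esub> b) (r \<otimes>\<^bsub>S\<^esub> s)"
  and tens_induct: "\<lbrakk>x \<in> carrier T; P \<zero>\<^bsub>T\<^esub>;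
      \<And>y a s. \<lbrakk>y \<in> carrier T; a \<in> carrier A; s \<in> carrier S; P y\<rbrakk> \<Longrightarrow> P (y \<oplus>\<^bsub>T\<^esub> tens a s)\<rbrakk>
      \<Longrightarrow> P x"
  and slice_exists: "linear_form F S \<phi> \<Longrightarrow>
      \<exists>k. linear_map F T A k \<and> (\<forall>a\<in>carrier A. \<forall>s\<in>carrier S. k (tens a s) = \<phi> s \<odot>\<^bsub>A\<^esub> a)"
begin

text \<open>This is \<open>id \<otimes> \<phi>\<close>.\<close>

definition slice :: "('s \<Rightarrow> 'f) \<Rightarrow> 't \<Rightarrow> 'a" where
  "slice \<phi> = (SOME k. linear_map F T A k \<and>
    (\<forall>a\<in>carrier A. \<forall>s\<in>carrier S. k (tens a s) = \<phi> s \<odot>\<^bsub>A\<^esub> a))"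

lemma
  assumes "linear_form F S \<phi>"
  shows slice_linear: "linear_map F T A (slice \<phi>)"
    and slice_tens: "\<lbrakk>a \<in> carrier A; s \<in> carrier S\<rbrakk> \<Longrightarrow> slice \<phi> (tens a s) = \<phi> s \<odot>\<^bsub>A\<^esub> a"
  using someI_ex[OF slice_exists[OF assms]] unfolding slice_def by blast+

lemmas slice_closed = linear_mapD(1)[OF slice_linear]
  and slice_add = linear_mapD(2)[OF slice_linear]
  and slice_zero = linear_map_zero[OF slice_linear T.module_axioms A.module_axioms]

lemma tens_zero_left: "s \<in> carrier S \<Longrightarrow> tens \<zero>\<^bsub>A\<^esub> s = \<zero>\<^bsub>T\<^esub>"
  using tens_smult_left[of "\<zero>\<^bsub>F\<^esub>" "\<zero>\<^bsub>A\<^esub>" s] by simp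

lemma tens_zero_right: "a \<in> carrier A \<Longrightarrow> tens a \<zero>\<^bsub>S\<^esub> = \<zero>\<^bsub>T\<^esub>"
  using tens_smult_right[of "\<zero>\<^bsub>F\<^esub>" a "\<zero>\<^bsub>S\<^esub>"] by simp

lemma T_zero_mult: "x \<in> carrier T \<Longrightarrow> \<zero>\<^bsub>T\<^esub> \<otimes>\<^bsub>T\<^esub> x = \<zero>\<^bsub>T\<^esub>"
  using T_add_mult[of "\<zero>\<^bsub>T\<^esub>" "\<zero>\<^bsub>T\<^esub>" x] by (simp add: T.M.add.r_cancel_one')

lemma T_mult_zero: "x \<in> carrier T \<Longrightarrow> x \<otimes>\<^bsub>T\<^esub> \<zero>\<^bsub>T\<^esub> = \<zero>\<^bsub>T\<^esub>"
  using T_mult_add[of x "\<zero>\<^bsub>T\<^esub>" "\<zero>\<^bsub>T\<^esub>"] by (simp add: T.M.add.r_cancel_one')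

section \<open>Sums of pure tensors and their separation by slices\<close>

primrec tens_sum :: "('a \<times> 's) list \<Rightarrow> 't" where
  "tens_sum [] = \<zero>\<^bsub>T\<^esub>"
| "tens_sum (p # ps) = tens (fst p) (snd p) \<oplus>\<^bsub>T\<^esub> tens_sum ps"

lemma tens_sum_closed: "set ps \<subseteq> carrier A \<times> carrier S \<Longrightarrow> tens_sum ps \<in> carrier T"
  by (induction ps) auto

lemma exists_tens_sum:
  assumes "x \<in> carrier T"
  shows "\<exists>ps. set ps \<subseteq> carrier A \<times> carrier S \<and> x = tens_sum ps"
  using assms
proof (rule tens_induct)
  show "\<exists>ps. set ps \<subseteq> carrier A \<times> carrier S \<and> \<zero>\<^bsub>T\<^esub> = tens_sum ps" by (rule exI[of _ "[]"]) simp
  fix y a s assume y: "y \<in> carrier T" and a: "a \<in> carrier A" and s: "s \<in> carrier S"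
    and "\<exists>ps. set ps \<subseteq> carrier A \<times> carrier S \<and> y = tens_sum ps"
  then obtain ps where "set ps \<subseteq> carrier A \<times> carrier S" "y = tens_sum ps" by blast
  then show "\<exists>ps. set ps \<subseteq> carrier A \<times> carrier S \<and> y \<oplus>\<^bsub>T\<^esub> tens a s = tens_sum ps"
    using y a s by (intro exI[of _ "(a, s) # ps"]) (auto simp: T.M.a_comm)
qed

text \<open>If v is a combination of the second factors s_i with coefficients c_i, then a \<otimes>
  v is the sum of the (c_i a) \<otimes> s_i, so each term merges with the summand b_i \<otimes> s_i
  into (b_i + c_i a) \<otimes> s_i. The equality of lengths is the point: a summand with a dependent
  second factor can be removed without creating a new one.\<close>

lemma tens_sum_absorb:
  assumes "set ps \<subseteq> carrier A \<times> carrier S" "a \<in> carrier A" "v \<in> list_span F S (map snd ps)"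
  shows "\<exists>qs. set qs \<subseteq> carrier A \<times> carrier S \<and> length qs = length ps \<and>
    tens a v \<oplus>\<^bsub>T\<^esub> tens_sum ps = tens_sum qs"
  using assms
proof (induction ps arbitrary: v)
  case Nil
  then show ?case by (simp add: tens_zero_right)
next
  case (Cons p ps)
  obtain b s where p: "p = (b, s)" by (cases p)
  have bs: "b \<in> carrier A" "s \<in> carrier S" and ps: "set ps \<subseteq> carrier A \<times> carrier S"
    and a: "a \<in> carrier A"
    using Cons.prems p by auto
  obtain w c where v: "v = w \<oplus>\<^bsub>S\<^esub> c \<odot>\<^bsub>S\<^esub> s" and w: "w \<in> list_span F S (map snd ps)"
    and c: "c \<in> carrier F"
    using Cons.prems(3) p by (auto simp: adjoin_vector_def)
  have "submodule (list_span F S (map snd ps)) F S"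
    using ps by (intro S.submodule_list_span) auto
  then have wS: "w \<in> carrier S" using S.submoduleE(1) w by blast
  obtain qs where qs: "set qs \<subseteq> carrier A \<times> carrier S" "length qs = length ps"
    "tens a w \<oplus>\<^bsub>T\<^esub> tens_sum ps = tens_sum qs"
    using Cons.IH[OF ps a w] by blast
  note cl = tens_sum_closed[OF ps] tens_sum_closed[OF qs(1)]
  have "tens a v \<oplus>\<^bsub>T\<^esub> tens_sum (p # ps)
      = (tens a w \<oplus>\<^bsub>T\<^esub> tens (c \<odot>\<^bsub>A\<^esub> a) s) \<oplus>\<^bsub>T\<^esub> (tens b s \<oplus>\<^bsub>T\<^esub> tens_sum ps)"
    using a bs c wS v p by (simp add: tens_add_right tens_smult_right tens_smult_left)
  also have "\<dots> = tens (b \<oplus>\<^bsub>A\<^esub> c \<odot>\<^bsub>A\<^esub> a) s \<oplus>\<^bsub>T\<^esub> (tens a w \<oplus>\<^bsub>T\<^esub> tens_sum ps)"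
    using a bs c wS cl by (simp add: tens_add_left T.M.a_ac)
  finally show ?case
    using qs bs a c p by (intro exI[of _ "(b \<oplus>\<^bsub>A\<^esub> c \<odot>\<^bsub>A\<^esub> a, s) # qs"]) auto
qed

text \<open>Induction on the number of summands takes the place of a shortest representation. If the
  second factor \<open>s\<close> of the head lies in the span of the others, the head is absorbed.
  Otherwise a form that is one at \<open>s\<close> and vanishes on that span slices the sum to the
  first factor \<open>a\<close>, so \<open>a\<close> is zero and the head drops out. Either way a
  shorter sum represents the same element.\<close>

lemma slice_separates_zero:
  assumes "x \<in> carrier T" and zero: "\<And>\<phi>. linear_form F S \<phi> \<Longrightarrow> slice \<phi> x = \<zero>\<^bsub>A\<^esub>"
  shows "x = \<zero>\<^bsub>T\<^esub>"
proof -
  have "tens_sum ps = \<zero>\<^bsub>T\<^esub>"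
    if "set ps \<subseteq> carrier A \<times> carrier S"
      and "\<And>\<phi>. linear_form F S \<phi> \<Longrightarrow> slice \<phi> (tens_sum ps) = \<zero>\<^bsub>A\<^esub>" for ps
    using that
  proof (induction "length ps" arbitrary: ps)
    case 0
    then show ?case by simp
  next
    case (Suc n)
    then obtain p qs where ps: "ps = p # qs" by (cases ps) auto
    obtain a s where p: "p = (a, s)" by (cases p)
    have a: "a \<in> carrier A" and s: "s \<in> carrier S" and qs: "set qs \<subseteq> carrier A \<times> carrier S"
      and n: "n = length qs"
      using Suc.prems Suc.hyps(2) ps p by auto
    have sndqs: "set (map snd qs) \<subseteq> carrier S" using qs by auto
    show ?case
    proof (cases "s \<in> list_span F S (map snd qs)")
      case True
      then obtain rs where rs: "set rs \<subseteq> carrier A \<times> carrier S" "length rs = length qs"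
        "tens a s \<oplus>\<^bsub>T\<^esub> tens_sum qs = tens_sum rs"
        using tens_sum_absorb[OF qs a] by blast
      then have "tens_sum ps = tens_sum rs" using ps p by simp
      then show ?thesis using Suc.hyps(1)[of rs] Suc.prems(2) rs n by simp
    next
      case False
      obtain \<phi> where phi: "linear_form F S \<phi>" "\<phi> s = \<one>\<^bsub>F\<^esub>"
        "\<forall>w\<in>list_span F S (map snd qs). \<phi> w = \<zero>\<^bsub>F\<^esub>"
        using exists_separating_linear_form[OF F.field_axioms S.module_axioms
            S.submodule_list_span[OF sndqs] s False] by blast
      \<comment> \<open>The form is known to vanish on the span belonging to all of
        \<open>qs\<close>, so the induction runs over a list \<open>rs\<close> with entries from
        \<open>qs\<close> while that span stays fixed.\<close>
      have "slice \<phi> (tens_sum rs) = \<zero>\<^bsub>A\<^esub>" if "set rs \<subseteq> set qs" for rs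
        using that
      proof (induction rs)
        case Nil
        then show ?case using slice_zero[OF phi(1)] by simp
      next
        case (Cons r rs)
        have r: "fst r \<in> carrier A" "snd r \<in> carrier S" "set rs \<subseteq> carrier A \<times> carrier S"
          using Cons.prems qs by auto
        have "\<phi> (snd r) = \<zero>\<^bsub>F\<^esub>"
          using phi(3) Cons.prems by (auto intro!: S.list_span_mem[OF sndqs])
        then show ?case
          using Cons r phi(1) tens_sum_closed[OF r(3)] by (simp add: slice_add slice_tens)
      qed
      from this[of qs] have "slice \<phi> (tens_sum ps) = a"
        using ps p a s phi tens_sum_closed[OF qs] by (simp add: slice_add slice_tens)
      then have "a = \<zero>\<^bsub>A\<^esub>" using Suc.prems(2)[OF phi(1)] by simp
      then have "tens_sum ps = tens_sum qs"
        using ps p s tens_sum_closed[OF qs] by (simp add: tens_zero_left)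
      then show ?thesis using Suc.hyps(1)[of qs] Suc.prems(2) qs n by simp
    qed
  qed
  then show ?thesis using exists_tens_sum[OF assms(1)] zero by blast
qed

lemma slice_separates:
  assumes x: "x \<in> carrier T" and y: "y \<in> carrier T"
    and eq: "\<And>\<phi>. linear_form F S \<phi> \<Longrightarrow> slice \<phi> x = slice \<phi> y"
  shows "x = y"
proof -
  have "x \<ominus>\<^bsub>T\<^esub> y = \<zero>\<^bsub>T\<^esub>"
  proof (rule slice_separates_zero)
    fix \<phi> assume phi: "linear_form F S \<phi>"
    note k = slice_linear[OF phi]
    have "slice \<phi> (x \<ominus>\<^bsub>T\<^esub> y) \<oplus>\<^bsub>A\<^esub> slice \<phi> y = slice \<phi> ((x \<ominus>\<^bsub>T\<^esub> y) \<oplus>\<^bsub>T\<^esub> y)"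
      using linear_mapD(2)[OF k] x y by simp
    also have "(x \<ominus>\<^bsub>T\<^esub> y) \<oplus>\<^bsub>T\<^esub> y = x"
      using x y by (simp add: a_minus_def T.M.a_assoc T.M.l_neg)
    finally show "slice \<phi> (x \<ominus>\<^bsub>T\<^esub> y) = \<zero>\<^bsub>A\<^esub>"
      using eq[OF phi] linear_mapD(1)[OF k] x y by (simp add: A.M.add.r_cancel_one)
  qed (use x y in simp)
  then show ?thesis using x y T.M.minus_equality[of x "\<ominus>\<^bsub>T\<^esub> y"] by (simp add: a_minus_def)
qed

section \<open>Slices of products and the transfer of the property\<close>

lemma linear_form_translate:
  assumes "linear_form F S \<phi>" "r \<in> carrier S"
  shows "linear_form F S (\<lambda>s. \<phi> (r \<otimes>\<^bsub>S\<^esub> s))"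
  using assms linear_formD[OF assms(1)] unfolding linear_form_def
  by (auto simp: S.mult_closed S.mult_add S.mult_smult)

text \<open>Both sides are additive in \<open>x\<close>, and for x = b \<otimes> s both equal
  \<phi>(rs) ab. General \<open>x\<close> is required because the lemma is applied to values of
  \<open>g\<close> and \<open>h\<close>.\<close>

lemma slice_tens_mult:
  assumes phi: "linear_form F S \<phi>" and a: "a \<in> carrier A" and r: "r \<in> carrier S"
    and x: "x \<in> carrier T"
  shows "slice \<phi> (tens a r \<otimes>\<^bsub>T\<^esub> x) = a \<otimes>\<^bsub>A\<^esub> slice (\<lambda>s. \<phi> (r \<otimes>\<^bsub>S\<^esub> s)) x"
  using x
proof (rule tens_induct)
  note psi = linear_form_translate[OF phi r]
  show "slice \<phi> (tens a r \<otimes>\<^bsub>T\<^esub> \<zero>\<^bsub>T\<^esub>) = a \<otimes>\<^bsub>A\<^esub> slice (\<lambda>s. \<phi> (r \<otimes>\<^bsub>S\<^esub> s)) \<zero>\<^bsub>T\<^esub>"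
    using a r by (simp add: T_mult_zero slice_zero[OF phi] slice_zero[OF psi])
  fix y b s assume y: "y \<in> carrier T" and b: "b \<in> carrier A" and s: "s \<in> carrier S"
    and IH: "slice \<phi> (tens a r \<otimes>\<^bsub>T\<^esub> y) = a \<otimes>\<^bsub>A\<^esub> slice (\<lambda>s. \<phi> (r \<otimes>\<^bsub>S\<^esub> s)) y"
  show "slice \<phi> (tens a r \<otimes>\<^bsub>T\<^esub> (y \<oplus>\<^bsub>T\<^esub> tens b s))
      = a \<otimes>\<^bsub>A\<^esub> slice (\<lambda>s. \<phi> (r \<otimes>\<^bsub>S\<^esub> s)) (y \<oplus>\<^bsub>T\<^esub> tens b s)"
    using a r b s y IH linear_formD(1)[OF phi]
    by (simp add: T_mult_add slice_add[OF phi] slice_add[OF psi] tens_mult A.mult_closed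
        S.mult_closed slice_tens[OF phi] slice_tens[OF psi] A.mult_add A.mult_smult
        slice_closed[OF psi])
qed

text \<open>Both sides are biadditive in \<open>x\<close> and \<open>y\<close>, so pure tensors
  suffice: \<open>y\<close> is decomposed with a pure left factor held fixed, then \<open>x\<close>.
  Only one of the two identities of a left derivation is treated, with \<open>g\<close> and
  \<open>h\<close> free, so that exchanging them covers the other.\<close>

lemma left_identity_from_tens:
  assumes f: "linear_endo F T f" and g: "linear_endo F T g" and h: "linear_endo F T h"
    and pure: "\<And>a b r s. \<lbrakk>a \<in> carrier A; b \<in> carrier A; r \<in> carrier S; s \<in> carrier S\<rbrakk> \<Longrightarrow>
      f (tens a r \<otimes>\<^bsub>T\<^esub> tens b s) = tens a r \<otimes>\<^bsub>T\<^esub> g (tens b s) \<oplus>\<^bsub>T\<^esub> tens b s \<otimes>\<^bsub>T\<^esub> h (tens a r)"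
    and x: "x \<in> carrier T" and y: "y \<in> carrier T"
  shows "f (x \<otimes>\<^bsub>T\<^esub> y) = x \<otimes>\<^bsub>T\<^esub> g y \<oplus>\<^bsub>T\<^esub> y \<otimes>\<^bsub>T\<^esub> h x"
proof -
  note [simp] = linear_mapD(1)[OF f[unfolded linear_endo_iff]]
    linear_mapD(1)[OF g[unfolded linear_endo_iff]] linear_mapD(1)[OF h[unfolded linear_endo_iff]]
  note add = linear_mapD(2)[OF f[unfolded linear_endo_iff]]
    linear_mapD(2)[OF g[unfolded linear_endo_iff]] linear_mapD(2)[OF h[unfolded linear_endo_iff]]
  note [simp] = linear_map_zero[OF f[unfolded linear_endo_iff] T.module_axioms T.module_axioms]
    linear_map_zero[OF g[unfolded linear_endo_iff] T.module_axioms T.module_axioms]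
    linear_map_zero[OF h[unfolded linear_endo_iff] T.module_axioms T.module_axioms]
  have half: "f (tens a r \<otimes>\<^bsub>T\<^esub> y) = tens a r \<otimes>\<^bsub>T\<^esub> g y \<oplus>\<^bsub>T\<^esub> y \<otimes>\<^bsub>T\<^esub> h (tens a r)"
    if a: "a \<in> carrier A" and r: "r \<in> carrier S" for a r
    using y
  proof (rule tens_induct)
    fix z b s assume "z \<in> carrier T" "b \<in> carrier A" "s \<in> carrier S"
      "f (tens a r \<otimes>\<^bsub>T\<^esub> z) = tens a r \<otimes>\<^bsub>T\<^esub> g z \<oplus>\<^bsub>T\<^esub> z \<otimes>\<^bsub>T\<^esub> h (tens a r)"
    then show "f (tens a r \<otimes>\<^bsub>T\<^esub> (z \<oplus>\<^bsub>T\<^esub> tens b s))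
      = tens a r \<otimes>\<^bsub>T\<^esub> g (z \<oplus>\<^bsub>T\<^esub> tens b s) \<oplus>\<^bsub>T\<^esub> (z \<oplus>\<^bsub>T\<^esub> tens b s) \<otimes>\<^bsub>T\<^esub> h (tens a r)"
      using a r pure[OF a _ r] by (simp add: T_mult_add T_add_mult add T.M.a_ac)
  qed (use a r in \<open>simp add: T_mult_zero T_zero_mult\<close>)
  show ?thesis
    using x
  proof (rule tens_induct)
    fix z a r assume "z \<in> carrier T" "a \<in> carrier A" "r \<in> carrier S"
      "f (z \<otimes>\<^bsub>T\<^esub> y) = z \<otimes>\<^bsub>T\<^esub> g y \<oplus>\<^bsub>T\<^esub> y \<otimes>\<^bsub>T\<^esub> h z"
    then show "f ((z \<oplus>\<^bsub>T\<^esub> tens a r) \<otimes>\<^bsub>T\<^esub> y)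
      = (z \<oplus>\<^bsub>T\<^esub> tens a r) \<otimes>\<^bsub>T\<^esub> g y \<oplus>\<^bsub>T\<^esub> y \<otimes>\<^bsub>T\<^esub> h (z \<oplus>\<^bsub>T\<^esub> tens a r)"
      using y half by (simp add: T_mult_add T_add_mult add T.M.a_ac)
  qed (use y in \<open>simp add: T_mult_zero T_zero_mult\<close>)
qed

lemma jordan_left_gh_derivations_are_left_tensor:
  assumes A_left: "jordan_left_gh_derivations_are_left F A"
  shows "jordan_left_gh_derivations_are_left F T"
  unfolding jordan_left_gh_derivations_are_left_def
proof (intro allI impI, elim conjE)
  fix f g h
  assume f: "linear_endo F T f" and g: "linear_endo F T g" and h: "linear_endo F T h"
    and jordan: "jordan_left_gh_derivation T g h f"
  note f' = linear_mapD[OF f[unfolded linear_endo_iff]]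
  note g' = linear_mapD[OF g[unfolded linear_endo_iff]]
  note h' = linear_mapD[OF h[unfolded linear_endo_iff]]
  have endo: "linear_endo F A (\<lambda>a. slice \<phi> (k (tens a t)))"
    if phi: "linear_form F S \<phi>" and k: "linear_endo F T k" and t: "t \<in> carrier S" for \<phi> k t
    using linear_mapD[OF k[unfolded linear_endo_iff]] linear_mapD[OF slice_linear[OF phi]] t
    by (auto simp: linear_endo_def tens_add_left tens_smult_left)
  have sliced: "left_gh_derivation A (\<lambda>b. slice (\<lambda>t. \<phi> (r \<otimes>\<^bsub>S\<^esub> t)) (g (tens b s)))
      (\<lambda>a. slice (\<lambda>t. \<phi> (s \<otimes>\<^bsub>S\<^esub> t)) (h (tens a r))) (\<lambda>a. slice \<phi> (f (tens a (r \<otimes>\<^bsub>S\<^esub> s))))"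
    if phi: "linear_form F S \<phi>" and r: "r \<in> carrier S" and s: "s \<in> carrier S" for \<phi> r s
  proof -
    let ?g = "\<lambda>b. slice (\<lambda>t. \<phi> (r \<otimes>\<^bsub>S\<^esub> t)) (g (tens b s))"
    let ?h = "\<lambda>a. slice (\<lambda>t. \<phi> (s \<otimes>\<^bsub>S\<^esub> t)) (h (tens a r))"
    note psi = linear_form_translate[OF phi r] linear_form_translate[OF phi s]
    have "jordan_left_gh_derivation A ?g ?h (\<lambda>a. slice \<phi> (f (tens a (r \<otimes>\<^bsub>S\<^esub> s))))"
      unfolding jordan_left_gh_derivation_def
    proof (intro ballI)
      fix a b assume a: "a \<in> carrier A" and b: "b \<in> carrier A"
      \<comment> \<open>The Jordan identity equates the value of \<open>f\<close> with the double of
        \<open>X\<close>. Since the double is \<open>X\<close> added to itself, it passes through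
        the slice by additivity.\<close>
      define X where "X = tens a r \<otimes>\<^bsub>T\<^esub> g (tens b s) \<oplus>\<^bsub>T\<^esub> tens b s \<otimes>\<^bsub>T\<^esub> h (tens a r)"
      have X: "X \<in> carrier T" using a b r s g'(1) h'(1) by (simp add: X_def)
      have slX: "slice \<phi> X = a \<otimes>\<^bsub>A\<^esub> ?g b \<oplus>\<^bsub>A\<^esub> b \<otimes>\<^bsub>A\<^esub> ?h a"
        using a b r s g'(1) h'(1) by (simp add: X_def slice_add[OF phi] slice_tens_mult[OF phi])
      \<comment> \<open>The product of b \<otimes> s and a \<otimes> r has second factor s r;
        commutativity of \<open>S\<close> turns it into r s, so that both products share it and
        combine into one pure tensor.\<close>
      have "tens (a \<otimes>\<^bsub>A\<^esub> b \<oplus>\<^bsub>A\<^esub> b \<otimes>\<^bsub>A\<^esub> a) (r \<otimes>\<^bsub>S\<^esub> s)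
          = tens a r \<otimes>\<^bsub>T\<^esub> tens b s \<oplus>\<^bsub>T\<^esub> tens b s \<otimes>\<^bsub>T\<^esub> tens a r"
        using a b r s
        by (simp add: tens_mult tens_add_left A.mult_closed S.mult_closed S.mult_comm[OF s r])
      then have "f (tens (a \<otimes>\<^bsub>A\<^esub> b \<oplus>\<^bsub>A\<^esub> b \<otimes>\<^bsub>A\<^esub> a) (r \<otimes>\<^bsub>S\<^esub> s)) = add_pow T (2::nat) X"
        using jordan a b r s by (simp add: jordan_left_gh_derivation_def X_def)
      also have "\<dots> = X \<oplus>\<^bsub>T\<^esub> X" using X by (simp add: numeral_2_eq_2)
      finally have "slice \<phi> (f (tens (a \<otimes>\<^bsub>A\<^esub> b \<oplus>\<^bsub>A\<^esub> b \<otimes>\<^bsub>A\<^esub> a) (r \<otimes>\<^bsub>S\<^esub> s)))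
          = slice \<phi> X \<oplus>\<^bsub>A\<^esub> slice \<phi> X"
        using X by (simp add: slice_add[OF phi])
      also have "\<dots> = add_pow A (2::nat) (slice \<phi> X)"
        using slice_closed[OF phi X] by (simp add: numeral_2_eq_2)
      finally show "slice \<phi> (f (tens (a \<otimes>\<^bsub>A\<^esub> b \<oplus>\<^bsub>A\<^esub> b \<otimes>\<^bsub>A\<^esub> a) (r \<otimes>\<^bsub>S\<^esub> s)))
          = add_pow A (2::nat) (a \<otimes>\<^bsub>A\<^esub> ?g b \<oplus>\<^bsub>A\<^esub> b \<otimes>\<^bsub>A\<^esub> ?h a)"
        unfolding slX .
    qed
    then show ?thesis
      using A_left endo[OF phi f S.mult_closed[OF r s]] endo[OF psi(1) g s] endo[OF psi(2) h r]
      unfolding jordan_left_gh_derivations_are_left_def by blast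
  qed
  have pure1: "f (tens a r \<otimes>\<^bsub>T\<^esub> tens b s)
      = tens a r \<otimes>\<^bsub>T\<^esub> g (tens b s) \<oplus>\<^bsub>T\<^esub> tens b s \<otimes>\<^bsub>T\<^esub> h (tens a r)"
    if a: "a \<in> carrier A" and b: "b \<in> carrier A" and r: "r \<in> carrier S" and s: "s \<in> carrier S"
    for a b r s
  proof (rule slice_separates)
    fix \<phi> assume phi: "linear_form F S \<phi>"
    show "slice \<phi> (f (tens a r \<otimes>\<^bsub>T\<^esub> tens b s))
      = slice \<phi> (tens a r \<otimes>\<^bsub>T\<^esub> g (tens b s) \<oplus>\<^bsub>T\<^esub> tens b s \<otimes>\<^bsub>T\<^esub> h (tens a r))"
      using sliced[OF phi r s] a b r s g'(1) h'(1)
      by (simp add: left_gh_derivation_def tens_mult slice_add[OF phi] slice_tens_mult[OF phi])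
  qed (use a b r s f'(1) g'(1) h'(1) in simp_all)
  \<comment> \<open>The second identity on \<open>A\<close> is used with \<open>r\<close> and \<open>s\<close> interchanged.\<close>
  have pure2: "f (tens a r \<otimes>\<^bsub>T\<^esub> tens b s)
      = tens a r \<otimes>\<^bsub>T\<^esub> h (tens b s) \<oplus>\<^bsub>T\<^esub> tens b s \<otimes>\<^bsub>T\<^esub> g (tens a r)"
    if a: "a \<in> carrier A" and b: "b \<in> carrier A" and r: "r \<in> carrier S" and s: "s \<in> carrier S"
    for a b r s
  proof (rule slice_separates)
    fix \<phi> assume phi: "linear_form F S \<phi>"
    have "slice \<phi> (f (tens (a \<otimes>\<^bsub>A\<^esub> b) (s \<otimes>\<^bsub>S\<^esub> r)))
      = a \<otimes>\<^bsub>A\<^esub> slice (\<lambda>t. \<phi> (r \<otimes>\<^bsub>S\<^esub> t)) (h (tens b s))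
        \<oplus>\<^bsub>A\<^esub> b \<otimes>\<^bsub>A\<^esub> slice (\<lambda>t. \<phi> (s \<otimes>\<^bsub>S\<^esub> t)) (g (tens a r))"
      using sliced[OF phi s r] a b unfolding left_gh_derivation_def by blast
    also have "\<dots> = slice \<phi> (tens a r \<otimes>\<^bsub>T\<^esub> h (tens b s) \<oplus>\<^bsub>T\<^esub> tens b s \<otimes>\<^bsub>T\<^esub> g (tens a r))"
      using a b r s g'(1) h'(1) by (simp add: slice_add[OF phi] slice_tens_mult[OF phi])
    finally have "slice \<phi> (f (tens (a \<otimes>\<^bsub>A\<^esub> b) (s \<otimes>\<^bsub>S\<^esub> r)))
      = slice \<phi> (tens a r \<otimes>\<^bsub>T\<^esub> h (tens b s) \<oplus>\<^bsub>T\<^esub> tens b s \<otimes>\<^bsub>T\<^esub> g (tens a r))" .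
    then show "slice \<phi> (f (tens a r \<otimes>\<^bsub>T\<^esub> tens b s))
      = slice \<phi> (tens a r \<otimes>\<^bsub>T\<^esub> h (tens b s) \<oplus>\<^bsub>T\<^esub> tens b s \<otimes>\<^bsub>T\<^esub> g (tens a r))"
      using a b r s by (simp add: tens_mult S.mult_comm[OF s r])
  qed (use a b r s f'(1) g'(1) h'(1) in simp_all)
  show "left_gh_derivation T g h f"
    unfolding left_gh_derivation_def
    using left_identity_from_tens[OF f g h pure1] left_identity_from_tens[OF f h g pure2] by blast
qed

end

subsection \<open>The tensor product as a quotient of the free module\<close>

lemma (in module) submodule_zero: "submodule {\<zero>\<^bsub>M\<^esub>} R M"
  by (rule submoduleI) auto

lemma linear_map_minus:
  assumes "linear_map F X Y k" "module F X" "module F Y" "x \<in> carrier X" "y \<in> carrier X"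
  shows "k (x \<ominus>\<^bsub>X\<^esub> y) = k x \<ominus>\<^bsub>Y\<^esub> k y"
proof -
  interpret X: module F X by fact
  interpret Y: module F Y by fact
  note k = linear_mapD[OF assms(1)]
  have "k (\<ominus>\<^bsub>X\<^esub> y) = k ((\<ominus>\<^bsub>F\<^esub> \<one>\<^bsub>F\<^esub>) \<odot>\<^bsub>X\<^esub> y)"
    using assms(5) by (simp add: X.smult_l_minus)
  also have "\<dots> = \<ominus>\<^bsub>Y\<^esub> k y"
    using assms(5) k by (simp add: Y.smult_l_minus)
  finally show ?thesis using assms k by (simp add: a_minus_def)
qed

definition linear_ext ::
  "('f, 'm) ring_scheme \<Rightarrow> ('f, 'x, 'n) module_scheme \<Rightarrow> ('i \<Rightarrow> 'x) \<Rightarrow> ('i \<Rightarrow> 'f) \<Rightarrow> 'x" where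
  "linear_ext F X k p = (\<Oplus>\<^bsub>X\<^esub>u\<in>{u. p u \<noteq> \<zero>\<^bsub>F\<^esub>}. p u \<odot>\<^bsub>X\<^esub> k u)"

locale algebra_pair = F: field F + A: assoc_algebra F A + S: comm_assoc_algebra F S
  for F :: "('f, 'm) ring_scheme" and A :: "('f, 'a, 'u) module_scheme"
    and S :: "('f, 's, 'v) module_scheme"
begin

abbreviation "M \<equiv> free_pair_algebra F A S"
abbreviation "N \<equiv> tensor_null F A S"
abbreviation "T \<equiv> tensor_algebra F A S"
abbreviation "\<delta> \<equiv> pair_delta F"

section \<open>The free module on pairs and linear extension from its basis\<close>

lemma M_simps:
  "carrier M = free_pairs F A S"
  "p \<oplus>\<^bsub>M\<^esub> q = (\<lambda>w. p w \<oplus>\<^bsub>F\<^esub> q w)"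
  "\<zero>\<^bsub>M\<^esub> = (\<lambda>_. \<zero>\<^bsub>F\<^esub>)"
  "c \<odot>\<^bsub>M\<^esub> p = (\<lambda>w. c \<otimes>\<^bsub>F\<^esub> p w)"
  by (simp_all add: free_pair_algebra_def)

lemma free_pairsD:
  assumes "p \<in> carrier M"
  shows "p u \<in> carrier F" and "finite {u. p u \<noteq> \<zero>\<^bsub>F\<^esub>}"
    and "{u. p u \<noteq> \<zero>\<^bsub>F\<^esub>} \<subseteq> carrier A \<times> carrier S"
  using assms by (auto simp: M_simps free_pairs_def)

lemma free_pairsI:
  assumes "\<And>u. p u \<in> carrier F" and "finite U" and "U \<subseteq> carrier A \<times> carrier S"
    and "\<And>u. u \<notin> U \<Longrightarrow> p u = \<zero>\<^bsub>F\<^esub>"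
  shows "p \<in> carrier M"
proof -
  have "{u. p u \<noteq> \<zero>\<^bsub>F\<^esub>} \<subseteq> U" using assms(4) by blast
  then show ?thesis
    using assms(1-3) finite_subset unfolding M_simps free_pairs_def by blast
qed

lemma module_M: "module F M"
proof (rule moduleI)
  show "cring F" by (rule F.is_cring)
  have add: "p \<oplus>\<^bsub>M\<^esub> q \<in> carrier M" if "p \<in> carrier M" "q \<in> carrier M" for p q
    using free_pairsD[OF that(1)] free_pairsD[OF that(2)]
    by (intro free_pairsI[of _ "{u. p u \<noteq> \<zero>\<^bsub>F\<^esub>} \<union> {u. q u \<noteq> \<zero>\<^bsub>F\<^esub>}"]) (auto simp: M_simps(2))
  have smult: "c \<odot>\<^bsub>M\<^esub> p \<in> carrier M" if "c \<in> carrier F" "p \<in> carrier M" for c p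
    using free_pairsD[OF that(2)] that(1)
    by (intro free_pairsI[of _ "{u. p u \<noteq> \<zero>\<^bsub>F\<^esub>}"]) (auto simp: M_simps(4))
  show "abelian_group M"
  proof (rule abelian_groupI)
    show "\<zero>\<^bsub>M\<^esub> \<in> carrier M" by (rule free_pairsI[of _ "{}"]) (auto simp: M_simps(3))
    show "\<exists>q\<in>carrier M. q \<oplus>\<^bsub>M\<^esub> p = \<zero>\<^bsub>M\<^esub>" if "p \<in> carrier M" for p
      using smult[OF _ that, of "\<ominus>\<^bsub>F\<^esub> \<one>\<^bsub>F\<^esub>"] free_pairsD(1)[OF that]
      by (intro bexI[of _ "(\<ominus>\<^bsub>F\<^esub> \<one>\<^bsub>F\<^esub>) \<odot>\<^bsub>M\<^esub> p"]) (auto simp: M_simps F.l_minus F.l_neg)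
  qed (use add free_pairsD(1) in \<open>auto simp: M_simps(2,3) F.a_ac\<close>)
  show "c \<odot>\<^bsub>M\<^esub> p \<in> carrier M" if "c \<in> carrier F" "p \<in> carrier M" for c p using that by (rule smult)
qed (use free_pairsD(1) in \<open>auto simp: M_simps(2-4) F.l_distr F.r_distr F.m_assoc\<close>)

sublocale M: module F M by (rule module_M)

lemma delta_closed [simp]: "\<lbrakk>x \<in> carrier A; r \<in> carrier S\<rbrakk> \<Longrightarrow> \<delta> x r \<in> carrier M"
  by (rule free_pairsI[of _ "{(x, r)}"]) (auto simp: pair_delta_def)

text \<open>A finitely supported function is a finite combination of basis vectors. The induction is
  over a finite set containing the support rather than over the support itself, so removing a point
  \<open>u\<close> needs no distinction according to whether \<open>p u\<close> vanishes.\<close>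

lemma M_induct:
  assumes p: "p \<in> carrier M" and zero: "P \<zero>\<^bsub>M\<^esub>"
    and step: "\<And>q c x r. \<lbrakk>q \<in> carrier M; c \<in> carrier F; x \<in> carrier A; r \<in> carrier S; P q\<rbrakk>
      \<Longrightarrow> P (q \<oplus>\<^bsub>M\<^esub> c \<odot>\<^bsub>M\<^esub> \<delta> x r)"
  shows "P p"
proof -
  have "P p" if "finite U" "U \<subseteq> carrier A \<times> carrier S" "p \<in> carrier M" "\<And>u. u \<notin> U \<Longrightarrow> p u = \<zero>\<^bsub>F\<^esub>"
    for U p
    using that
  proof (induction U arbitrary: p)
    case empty
    then have "p = \<zero>\<^bsub>M\<^esub>" by (auto simp: M_simps(3))
    then show ?case using zero by simp
  next
    case (insert u U)
    obtain x r where u: "u = (x, r)" "x \<in> carrier A" "r \<in> carrier S" using insert.prems(1) by auto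
    let ?q = "p(u := \<zero>\<^bsub>F\<^esub>)"
    have q: "?q \<in> carrier M"
      using free_pairsD[OF insert.prems(2)] insert
      by (intro free_pairsI[of _ U]) auto
    have "P ?q"
    proof (rule insert.IH[OF _ q])
      show "?q v = \<zero>\<^bsub>F\<^esub>" if "v \<notin> U" for v using insert.prems(3)[of v] that by auto
    qed (use insert.prems(1) in simp)
    then have "P (?q \<oplus>\<^bsub>M\<^esub> p u \<odot>\<^bsub>M\<^esub> \<delta> x r)"
      using q u free_pairsD(1)[OF insert.prems(2)] by (intro step) auto
    also have "?q \<oplus>\<^bsub>M\<^esub> p u \<odot>\<^bsub>M\<^esub> \<delta> x r = p"
      using u free_pairsD(1)[OF insert.prems(2)] by (auto simp: M_simps(2,4) pair_delta_def)
    finally show ?case .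
  qed
  from this[OF free_pairsD(2,3)[OF p] p] show ?thesis by simp
qed

context
  fixes X :: "('f, 'x, 'n) module_scheme"
  assumes X: "module F X"
begin

interpretation X: module F X by (rule X)

text \<open>The sum of two functions can have smaller support than either, through cancellation, so
  additivity of the extension can only be read off after all sums are taken over a common index
  set.\<close>

lemma linear_ext_superset:
  assumes p: "p \<in> carrier M" and k: "k \<in> carrier A \<times> carrier S \<rightarrow> carrier X"
    and U: "finite U" "{u. p u \<noteq> \<zero>\<^bsub>F\<^esub>} \<subseteq> U" "U \<subseteq> carrier A \<times> carrier S"
  shows "linear_ext F X k p = (\<Oplus>\<^bsub>X\<^esub>u\<in>U. p u \<odot>\<^bsub>X\<^esub> k u)"
  unfolding linear_ext_def
proof (rule X.M.add.finprod_mono_neutral_cong_left)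
  show "p u \<odot>\<^bsub>X\<^esub> k u = \<zero>\<^bsub>X\<^esub>" if "u \<in> U - {u. p u \<noteq> \<zero>\<^bsub>F\<^esub>}" for u
    using that U(3) funcset_mem[OF k] by auto
  show "(\<lambda>u. p u \<odot>\<^bsub>X\<^esub> k u) \<in> U \<rightarrow> carrier X"
    using U(3) funcset_mem[OF k] free_pairsD(1)[OF p] by auto
qed (use U in auto)

lemma linear_ext_linear:
  assumes k: "k \<in> carrier A \<times> carrier S \<rightarrow> carrier X"
  shows "linear_map F M X (linear_ext F X k)"
  unfolding linear_map_def
proof (intro conjI ballI)
  have fin: "(\<lambda>u. p u \<odot>\<^bsub>X\<^esub> k u) \<in> U \<rightarrow> carrier X"
    if "p \<in> carrier M" "U \<subseteq> carrier A \<times> carrier S" for p U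
    using that funcset_mem[OF k] free_pairsD(1) by auto
  show "linear_ext F X k \<in> carrier M \<rightarrow> carrier X"
    unfolding linear_ext_def using fin free_pairsD(3) by (auto intro!: X.M.finsum_closed)
  fix p assume p: "p \<in> carrier M"
  {
    fix q assume q: "q \<in> carrier M"
    let ?U = "{u. p u \<noteq> \<zero>\<^bsub>F\<^esub>} \<union> {u. q u \<noteq> \<zero>\<^bsub>F\<^esub>}"
    have U: "finite ?U" "?U \<subseteq> carrier A \<times> carrier S"
      using free_pairsD[OF p] free_pairsD[OF q] by auto
    have pq: "{u. (p \<oplus>\<^bsub>M\<^esub> q) u \<noteq> \<zero>\<^bsub>F\<^esub>} \<subseteq> ?U" by (auto simp: M_simps(2))
    have "linear_ext F X k (p \<oplus>\<^bsub>M\<^esub> q) = (\<Oplus>\<^bsub>X\<^esub>u\<in>?U. (p \<oplus>\<^bsub>M\<^esub> q) u \<odot>\<^bsub>X\<^esub> k u)"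
      using p q by (intro linear_ext_superset k U pq) auto
    also have "\<dots> = (\<Oplus>\<^bsub>X\<^esub>u\<in>?U. p u \<odot>\<^bsub>X\<^esub> k u \<oplus>\<^bsub>X\<^esub> q u \<odot>\<^bsub>X\<^esub> k u)"
    proof (rule X.M.finsum_cong')
      fix u assume "u \<in> ?U"
      then show "(p \<oplus>\<^bsub>M\<^esub> q) u \<odot>\<^bsub>X\<^esub> k u = p u \<odot>\<^bsub>X\<^esub> k u \<oplus>\<^bsub>X\<^esub> q u \<odot>\<^bsub>X\<^esub> k u"
        using funcset_mem[OF k subsetD[OF U(2)]] free_pairsD(1)[OF p] free_pairsD(1)[OF q]
        by (simp add: M_simps(2) X.smult_l_distr)
    qed (use fin[OF p U(2)] fin[OF q U(2)] in auto)
    also have "\<dots> = (\<Oplus>\<^bsub>X\<^esub>u\<in>?U. p u \<odot>\<^bsub>X\<^esub> k u) \<oplus>\<^bsub>X\<^esub> (\<Oplus>\<^bsub>X\<^esub>u\<in>?U. q u \<odot>\<^bsub>X\<^esub> k u)"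
      by (intro X.M.finsum_addf fin p q U)
    also have "\<dots> = linear_ext F X k p \<oplus>\<^bsub>X\<^esub> linear_ext F X k q"
      using linear_ext_superset[OF p k U(1) _ U(2)] linear_ext_superset[OF q k U(1) _ U(2)] by auto
    finally show "linear_ext F X k (p \<oplus>\<^bsub>M\<^esub> q) = linear_ext F X k p \<oplus>\<^bsub>X\<^esub> linear_ext F X k q" .
  }
  fix c assume c: "c \<in> carrier F"
  \<comment> \<open>The support of \<open>p\<close> serves as index set on both sides; that of the
    multiple is smaller when \<open>c\<close> is zero.\<close>
  let ?U = "{u. p u \<noteq> \<zero>\<^bsub>F\<^esub>}"
  note U = free_pairsD(2,3)[OF p]
  have "linear_ext F X k (c \<odot>\<^bsub>M\<^esub> p) = (\<Oplus>\<^bsub>X\<^esub>u\<in>?U. (c \<odot>\<^bsub>M\<^esub> p) u \<odot>\<^bsub>X\<^esub> k u)"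
    by (rule linear_ext_superset[OF M.smult_closed[OF c p] k U(1) _ U(2)])
      (use c in \<open>auto simp: M_simps(4)\<close>)
  also have "\<dots> = (\<Oplus>\<^bsub>X\<^esub>u\<in>?U. c \<odot>\<^bsub>X\<^esub> (p u \<odot>\<^bsub>X\<^esub> k u))"
  proof (rule X.M.finsum_cong')
    fix u assume "u \<in> ?U"
    then show "(c \<odot>\<^bsub>M\<^esub> p) u \<odot>\<^bsub>X\<^esub> k u = c \<odot>\<^bsub>X\<^esub> (p u \<odot>\<^bsub>X\<^esub> k u)"
      using funcset_mem[OF k subsetD[OF U(2)]] free_pairsD(1)[OF p] c
      by (simp add: M_simps(4) X.smult_assoc1)
  qed (use fin[OF p U(2)] c in auto)
  also have "\<dots> = c \<odot>\<^bsub>X\<^esub> linear_ext F X k p"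
    unfolding linear_ext_def by (rule X.finsum_smult_ldistr[symmetric, OF U(1) c fin[OF p U(2)]])
  finally show "linear_ext F X k (c \<odot>\<^bsub>M\<^esub> p) = c \<odot>\<^bsub>X\<^esub> linear_ext F X k p" .
qed

lemma linear_ext_delta:
  assumes "k \<in> carrier A \<times> carrier S \<rightarrow> carrier X" "x \<in> carrier A" "r \<in> carrier S"
  shows "linear_ext F X k (\<delta> x r) = k (x, r)"
proof -
  have "{u. \<delta> x r u \<noteq> \<zero>\<^bsub>F\<^esub>} = {(x, r)}" by (auto simp: pair_delta_def)
  then show ?thesis
    using funcset_mem[OF assms(1), of "(x, r)"] assms(2,3)
    by (simp add: linear_ext_def pair_delta_def)
qed

end

section \<open>Bilinearity of the product on the free module\<close>

lemma finsum_M_apply: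
  assumes "finite U" "f \<in> U \<rightarrow> carrier M"
  shows "(\<Oplus>\<^bsub>M\<^esub>u\<in>U. f u) w = (\<Oplus>\<^bsub>F\<^esub>u\<in>U. f u w)"
  using assms
proof (induction U)
  case (insert u U)
  then have "f u w \<in> carrier F" "(\<lambda>u. f u w) \<in> U \<rightarrow> carrier F"
    using free_pairsD(1) by blast+
  then show ?case using insert by (simp add: M_simps(2))
qed (simp add: M_simps(3))

abbreviation pair_mult :: "'a \<times> 's \<Rightarrow> 'a \<times> 's \<Rightarrow> 'a \<times> 's \<Rightarrow> 'f" where
  "pair_mult u v \<equiv> \<delta> (fst u \<otimes>\<^bsub>A\<^esub> fst v) (snd u \<otimes>\<^bsub>S\<^esub> snd v)"

lemma pair_mult_closed:
  "\<lbrakk>u \<in> carrier A \<times> carrier S; v \<in> carrier A \<times> carrier S\<rbrakk> \<Longrightarrow> pair_mult u v \<in> carrier M"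
  by (auto simp: A.mult_closed S.mult_closed)

lemma inner_closed:
  assumes "u \<in> carrier A \<times> carrier S" "q \<in> carrier M"
  shows "linear_ext F M (pair_mult u) q \<in> carrier M"
  using linear_mapD(1)[OF linear_ext_linear[OF module_M, of "pair_mult u"] assms(2)]
    pair_mult_closed[OF assms(1)] by blast

text \<open>The double sum defining the product becomes two nested linear extensions of the product
  of basis vectors. From here on bilinearity follows from linearity of extensions, without further
  manipulation of sums over supports.\<close>

lemma M_mult:
  assumes p: "p \<in> carrier M" and q: "q \<in> carrier M"
  shows "p \<otimes>\<^bsub>M\<^esub> q = linear_ext F M (\<lambda>u. linear_ext F M (pair_mult u) q) p"
proof
  fix w
  note pD = free_pairsD[OF p] and qD = free_pairsD[OF q]
  let ?P = "{u. p u \<noteq> \<zero>\<^bsub>F\<^esub>}" and ?Q = "{u. q u \<noteq> \<zero>\<^bsub>F\<^esub>}"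
  have inner: "linear_ext F M (pair_mult u) q w = (\<Oplus>\<^bsub>F\<^esub>v\<in>?Q. q v \<otimes>\<^bsub>F\<^esub> pair_mult u v w)"
    if "u \<in> ?P" for u
    unfolding linear_ext_def
  proof (subst finsum_M_apply)
    show "(\<lambda>v. q v \<odot>\<^bsub>M\<^esub> pair_mult u v) \<in> ?Q \<rightarrow> carrier M"
      using pair_mult_closed[OF subsetD[OF pD(3) that] subsetD[OF qD(3)]] qD(1) by auto
  qed (use qD(2) in \<open>simp_all add: M_simps(4)\<close>)
  have "linear_ext F M (\<lambda>u. linear_ext F M (pair_mult u) q) p w
      = (\<Oplus>\<^bsub>F\<^esub>u\<in>?P. p u \<otimes>\<^bsub>F\<^esub> linear_ext F M (pair_mult u) q w)"
    unfolding linear_ext_def[of F M "\<lambda>u. linear_ext F M (pair_mult u) q"]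
  proof (subst finsum_M_apply)
    show "(\<lambda>u. p u \<odot>\<^bsub>M\<^esub> linear_ext F M (pair_mult u) q) \<in> ?P \<rightarrow> carrier M"
      using inner_closed[OF subsetD[OF pD(3)] q] pD(1) by auto
  qed (use pD(2) in \<open>simp_all add: M_simps(4)\<close>)
  also have "\<dots> = (\<Oplus>\<^bsub>F\<^esub>u\<in>?P. \<Oplus>\<^bsub>F\<^esub>v\<in>?Q.
      (if (fst u \<otimes>\<^bsub>A\<^esub> fst v, snd u \<otimes>\<^bsub>S\<^esub> snd v) = w then p u \<otimes>\<^bsub>F\<^esub> q v else \<zero>\<^bsub>F\<^esub>))"
  proof (rule F.finsum_cong')
    fix u assume u: "u \<in> ?P"
    have "p u \<otimes>\<^bsub>F\<^esub> linear_ext F M (pair_mult u) q w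
        = p u \<otimes>\<^bsub>F\<^esub> (\<Oplus>\<^bsub>F\<^esub>v\<in>?Q. q v \<otimes>\<^bsub>F\<^esub> pair_mult u v w)"
      using inner[OF u] by simp
    also have "\<dots> = (\<Oplus>\<^bsub>F\<^esub>v\<in>?Q. p u \<otimes>\<^bsub>F\<^esub> (q v \<otimes>\<^bsub>F\<^esub> pair_mult u v w))"
      using pD qD by (intro F.finsum_rdistr) (auto simp: pair_delta_def)
    \<comment> \<open>At \<open>w\<close> the basis vector \<open>pair_mult u v\<close> is one if
      the product pair equals \<open>w\<close> and zero otherwise; this is the conditional in the
      definition of the product.\<close>
    also have "\<dots> = (\<Oplus>\<^bsub>F\<^esub>v\<in>?Q.
        (if (fst u \<otimes>\<^bsub>A\<^esub> fst v, snd u \<otimes>\<^bsub>S\<^esub> snd v) = w then p u \<otimes>\<^bsub>F\<^esub> q v else \<zero>\<^bsub>F\<^esub>))"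
      using pD(1) qD(1) by (intro F.finsum_cong') (auto simp: pair_delta_def)
    finally show "p u \<otimes>\<^bsub>F\<^esub> linear_ext F M (pair_mult u) q w = \<dots>" .
  qed (use pD(1) qD(1) in \<open>auto intro!: F.finsum_closed\<close>)
  finally show "(p \<otimes>\<^bsub>M\<^esub> q) w = linear_ext F M (\<lambda>u. linear_ext F M (pair_mult u) q) p w"
    by (simp add: free_pair_algebra_def)
qed

lemma M_mult_linear_left:
  assumes q: "q \<in> carrier M"
  shows "linear_map F M M (\<lambda>p. p \<otimes>\<^bsub>M\<^esub> q)"
proof -
  let ?k = "\<lambda>u. linear_ext F M (pair_mult u) q"
  have "?k \<in> carrier A \<times> carrier S \<rightarrow> carrier M" using inner_closed q by blast
  from linear_ext_linear[OF module_M this] show ?thesis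
    using q by (simp add: linear_map_def M_mult Pi_iff)
qed

lemma M_mult_delta_left:
  assumes "x \<in> carrier A" "r \<in> carrier S" "q \<in> carrier M"
  shows "\<delta> x r \<otimes>\<^bsub>M\<^esub> q = linear_ext F M (pair_mult (x, r)) q"
  using assms inner_closed
  by (simp add: M_mult linear_ext_delta[OF module_M, of "\<lambda>u. linear_ext F M (pair_mult u) q"])

lemma M_mult_delta:
  assumes "x \<in> carrier A" "r \<in> carrier S" "y \<in> carrier A" "s \<in> carrier S"
  shows "\<delta> x r \<otimes>\<^bsub>M\<^esub> \<delta> y s = \<delta> (x \<otimes>\<^bsub>A\<^esub> y) (r \<otimes>\<^bsub>S\<^esub> s)"
proof -
  have "pair_mult (x, r) \<in> carrier A \<times> carrier S \<rightarrow> carrier M"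
    using pair_mult_closed assms(1,2) by blast
  from linear_ext_delta[OF module_M this assms(3,4)] show ?thesis
    using assms by (simp add: M_mult_delta_left)
qed

text \<open>In \<open>M_mult\<close> the right factor sits inside the inner extension, so linearity
  in it is not immediate. Induction on \<open>p\<close> reduces it to a basis vector on the left,
  where the product is a single linear extension; homogeneity also uses that scalars
  commute.\<close>

lemma M_mult_linear_right:
  assumes p: "p \<in> carrier M"
  shows "linear_map F M M (\<lambda>q. p \<otimes>\<^bsub>M\<^esub> q)"
  using p
proof (rule M_induct)
  have "\<zero>\<^bsub>M\<^esub> \<otimes>\<^bsub>M\<^esub> q = \<zero>\<^bsub>M\<^esub>" if "q \<in> carrier M" for q
    using linear_map_zero[OF M_mult_linear_left[OF that] module_M module_M] .
  then show "linear_map F M M (\<lambda>q. \<zero>\<^bsub>M\<^esub> \<otimes>\<^bsub>M\<^esub> q)"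
    by (simp add: linear_map_def)
  fix p' c x r
  assume p': "p' \<in> carrier M" and c: "c \<in> carrier F" and x: "x \<in> carrier A" and r: "r \<in> carrier S"
    and IH: "linear_map F M M (\<lambda>q. p' \<otimes>\<^bsub>M\<^esub> q)"
  have "pair_mult (x, r) \<in> carrier A \<times> carrier S \<rightarrow> carrier M"
    using pair_mult_closed x r by blast
  from linear_ext_linear[OF module_M this] obtain L
    where L_eq: "L = linear_ext F M (pair_mult (x, r))" and L: "linear_map F M M L" by blast
  note L' = linear_mapD[OF L] and IH' = linear_mapD[OF IH]
  have eq: "(p' \<oplus>\<^bsub>M\<^esub> c \<odot>\<^bsub>M\<^esub> \<delta> x r) \<otimes>\<^bsub>M\<^esub> q = p' \<otimes>\<^bsub>M\<^esub> q \<oplus>\<^bsub>M\<^esub> c \<odot>\<^bsub>M\<^esub> L q"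
    if q: "q \<in> carrier M" for q
    using linear_mapD(2,3)[OF M_mult_linear_left[OF q]] p' c x r q
    by (simp add: M_mult_delta_left L_eq)
  have comm: "c \<odot>\<^bsub>M\<^esub> (d \<odot>\<^bsub>M\<^esub> q) = d \<odot>\<^bsub>M\<^esub> (c \<odot>\<^bsub>M\<^esub> q)" if "d \<in> carrier F" "q \<in> carrier M" for d q
    using that c by (simp add: M.smult_assoc1[symmetric] F.m_comm)
  show "linear_map F M M (\<lambda>q. (p' \<oplus>\<^bsub>M\<^esub> c \<odot>\<^bsub>M\<^esub> \<delta> x r) \<otimes>\<^bsub>M\<^esub> q)"
    unfolding linear_map_def using c
    by (auto simp: eq L' IH' M.smult_r_distr M.M.a_ac comm)
qed

lemma M_mult_closed: "\<lbrakk>p \<in> carrier M; q \<in> carrier M\<rbrakk> \<Longrightarrow> p \<otimes>\<^bsub>M\<^esub> q \<in> carrier M"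
  using linear_mapD(1)[OF M_mult_linear_left] by blast

section \<open>The null submodule is a two-sided ideal\<close>

lemma relators_subset: "tensor_relators F A S \<subseteq> carrier M"
  unfolding tensor_relators_def Let_def by auto

lemma relators_subset_null: "tensor_relators F A S \<subseteq> N"
  unfolding tensor_null_def by blast

lemma null_subset: "\<lbrakk>submodule W F M; tensor_relators F A S \<subseteq> W\<rbrakk> \<Longrightarrow> N \<subseteq> W"
  unfolding tensor_null_def by blast

text \<open>An intersection of submodules; the family is nonempty because the whole free module
  contains the relators, and this bounds the intersection by the carrier.\<close>

lemma submodule_null: "submodule N F M"
proof (rule M.submoduleI)
  note E = M.submoduleE
  show "N \<subseteq> carrier M" using null_subset M.carrier_is_submodule relators_subset by blast
  show "\<zero>\<^bsub>M\<^esub> \<in> N"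
    unfolding tensor_null_def using subgroup.one_closed[OF submodule.axioms(1)] by fastforce
  show "\<ominus>\<^bsub>M\<^esub> a \<in> N" if "a \<in> N" for a
    using that E(3) unfolding tensor_null_def by blast
  show "a \<oplus>\<^bsub>M\<^esub> b \<in> N" if "a \<in> N" "b \<in> N" for a b
    using that E(5) unfolding tensor_null_def by blast
  show "c \<odot>\<^bsub>M\<^esub> a \<in> N" if "c \<in> carrier F" "a \<in> N" for c a
    using that E(4) unfolding tensor_null_def by blast
qed

lemma submodule_vimage:
  assumes L: "linear_map F M X L" and X: "module F X" and W: "submodule W F X"
  shows "submodule {p \<in> carrier M. L p \<in> W} F M"
proof -
  interpret X: module F X by fact
  note W' = X.submoduleE[OF W] and L' = linear_mapD[OF L]
  have z: "\<zero>\<^bsub>X\<^esub> \<in> W" using subgroup.one_closed[OF submodule.axioms(1)[OF W]] by simp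
  have sm: "c \<odot>\<^bsub>M\<^esub> p \<in> {p \<in> carrier M. L p \<in> W}"
    if "c \<in> carrier F" "p \<in> {p \<in> carrier M. L p \<in> W}" for c p
    using that W'(4) by (auto simp: L')
  show ?thesis
  proof (rule M.submoduleI)
    show "\<ominus>\<^bsub>M\<^esub> p \<in> {p \<in> carrier M. L p \<in> W}" if "p \<in> {p \<in> carrier M. L p \<in> W}" for p
      using sm[OF _ that, of "\<ominus>\<^bsub>F\<^esub> \<one>\<^bsub>F\<^esub>"] that by (simp add: M.smult_l_minus)
  qed (use z W' sm linear_map_zero[OF L module_M X] in \<open>auto simp: L'\<close>)
qed

text \<open>The preimage of \<open>W\<close> under \<open>L\<close> is a submodule, so it contains
  \<open>N\<close> once it contains the generating relators. With \<open>W\<close> equal to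
  \<open>N\<close> and \<open>L\<close> a multiplication this gives the ideal property; with
  \<open>W\<close> zero and target \<open>A\<close> it makes a map descend to the quotient.\<close>

lemma linear_map_null:
  assumes L: "linear_map F M X L" and X: "module F X" and W: "submodule W F X"
    and 1: "\<And>x y r. \<lbrakk>x \<in> carrier A; y \<in> carrier A; r \<in> carrier S\<rbrakk> \<Longrightarrow>
      L (\<delta> (x \<oplus>\<^bsub>A\<^esub> y) r) \<ominus>\<^bsub>X\<^esub> (L (\<delta> x r) \<oplus>\<^bsub>X\<^esub> L (\<delta> y r)) \<in> W"
    and 2: "\<And>x r s. \<lbrakk>x \<in> carrier A; r \<in> carrier S; s \<in> carrier S\<rbrakk> \<Longrightarrow>
      L (\<delta> x (r \<oplus>\<^bsub>S\<^esub> s)) \<ominus>\<^bsub>X\<^esub> (L (\<delta> x r) \<oplus>\<^bsub>X\<^esub> L (\<delta> x s)) \<in> W"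
    and 3: "\<And>c x r. \<lbrakk>c \<in> carrier F; x \<in> carrier A; r \<in> carrier S\<rbrakk> \<Longrightarrow>
      L (\<delta> (c \<odot>\<^bsub>A\<^esub> x) r) \<ominus>\<^bsub>X\<^esub> c \<odot>\<^bsub>X\<^esub> L (\<delta> x r) \<in> W"
    and 4: "\<And>c x r. \<lbrakk>c \<in> carrier F; x \<in> carrier A; r \<in> carrier S\<rbrakk> \<Longrightarrow>
      L (\<delta> x (c \<odot>\<^bsub>S\<^esub> r)) \<ominus>\<^bsub>X\<^esub> c \<odot>\<^bsub>X\<^esub> L (\<delta> x r) \<in> W"
    and n: "n \<in> N"
  shows "L n \<in> W"
proof -
  note minus = linear_map_minus[OF L module_M X] and L' = linear_mapD[OF L]
  have "L p \<in> W" if "p \<in> tensor_relators F A S" for p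
    using that 1 2 3 4 unfolding tensor_relators_def Let_def
    by (auto simp: minus L')
  then have "tensor_relators F A S \<subseteq> {p \<in> carrier M. L p \<in> W}"
    using relators_subset by blast
  then show ?thesis using null_subset[OF submodule_vimage[OF L X W]] n by blast
qed

lemma relators_null:
  assumes "x \<in> carrier A" "r \<in> carrier S"
  shows "y \<in> carrier A \<Longrightarrow> \<delta> (x \<oplus>\<^bsub>A\<^esub> y) r \<ominus>\<^bsub>M\<^esub> (\<delta> x r \<oplus>\<^bsub>M\<^esub> \<delta> y r) \<in> N"
    and "s \<in> carrier S \<Longrightarrow> \<delta> x (r \<oplus>\<^bsub>S\<^esub> s) \<ominus>\<^bsub>M\<^esub> (\<delta> x r \<oplus>\<^bsub>M\<^esub> \<delta> x s) \<in> N"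
    and "c \<in> carrier F \<Longrightarrow> \<delta> (c \<odot>\<^bsub>A\<^esub> x) r \<ominus>\<^bsub>M\<^esub> c \<odot>\<^bsub>M\<^esub> \<delta> x r \<in> N"
    and "c \<in> carrier F \<Longrightarrow> \<delta> x (c \<odot>\<^bsub>S\<^esub> r) \<ominus>\<^bsub>M\<^esub> c \<odot>\<^bsub>M\<^esub> \<delta> x r \<in> N"
  by (rule subsetD[OF relators_subset_null], use assms in \<open>unfold tensor_relators_def Let_def, blast\<close>)+

lemmas null = M.submoduleE[OF submodule_null]

lemma null_zero: "\<zero>\<^bsub>M\<^esub> \<in> N"
  using subgroup.one_closed[OF submodule.axioms(1)[OF submodule_null]] by simp

text \<open>Multiplying a relator by a basis vector gives again a relator of the same kind, because
  the products of \<open>A\<close> and \<open>S\<close> are bilinear. Linearity in \<open>q\<close>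
  extends this to all right factors.\<close>

lemma null_mult_right:
  assumes n: "n \<in> N" and q: "q \<in> carrier M"
  shows "n \<otimes>\<^bsub>M\<^esub> q \<in> N"
  using q
proof (rule M_induct)
  have nM: "n \<in> carrier M" using null(1) n by blast
  note R = linear_mapD[OF M_mult_linear_right[OF nM]]
  show "n \<otimes>\<^bsub>M\<^esub> \<zero>\<^bsub>M\<^esub> \<in> N"
    using linear_map_zero[OF M_mult_linear_right[OF nM] module_M module_M] null_zero by simp
  fix q' c y s
  assume q': "q' \<in> carrier M" and c: "c \<in> carrier F" and y: "y \<in> carrier A" and s: "s \<in> carrier S"
    and IH: "n \<otimes>\<^bsub>M\<^esub> q' \<in> N"
  have "n \<otimes>\<^bsub>M\<^esub> \<delta> y s \<in> N"
    by (rule linear_map_null[OF M_mult_linear_left module_M submodule_null _ _ _ _ n])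
      (use y s in \<open>auto simp: M_mult_delta A.add_mult S.add_mult A.smult_mult S.smult_mult
        intro!: relators_null A.mult_closed S.mult_closed\<close>)
  then show "n \<otimes>\<^bsub>M\<^esub> (q' \<oplus>\<^bsub>M\<^esub> c \<odot>\<^bsub>M\<^esub> \<delta> y s) \<in> N"
    using q' c y s IH null by (simp add: R)
qed

text \<open>The mirror image of \<open>null_mult_right\<close>, based on distributivity in the
  second argument; a separate argument is made because \<open>A\<close> may be
  noncommutative.\<close>

lemma null_mult_left:
  assumes n: "n \<in> N" and p: "p \<in> carrier M"
  shows "p \<otimes>\<^bsub>M\<^esub> n \<in> N"
  using p
proof (rule M_induct)
  have nM: "n \<in> carrier M" using null(1) n by blast
  note R = linear_mapD[OF M_mult_linear_left[OF nM]]
  show "\<zero>\<^bsub>M\<^esub> \<otimes>\<^bsub>M\<^esub> n \<in> N"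
    using linear_map_zero[OF M_mult_linear_left[OF nM] module_M module_M] null_zero by simp
  fix q' c y s
  assume q': "q' \<in> carrier M" and c: "c \<in> carrier F" and y: "y \<in> carrier A" and s: "s \<in> carrier S"
    and IH: "q' \<otimes>\<^bsub>M\<^esub> n \<in> N"
  have "\<delta> y s \<otimes>\<^bsub>M\<^esub> n \<in> N"
    by (rule linear_map_null[OF M_mult_linear_right module_M submodule_null _ _ _ _ n])
      (use y s in \<open>auto simp: M_mult_delta A.mult_add S.mult_add A.mult_smult S.mult_smult
        intro!: relators_null A.mult_closed S.mult_closed\<close>)
  then show "(q' \<oplus>\<^bsub>M\<^esub> c \<odot>\<^bsub>M\<^esub> \<delta> y s) \<otimes>\<^bsub>M\<^esub> n \<in> N"
    using q' c y s IH null by (simp add: R)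
qed


section \<open>Operations on cosets and the axioms of the tensor product\<close>

sublocale null: abelian_subgroup N M
  using submodule.axioms(1)[OF submodule_null] M.abelian_group_axioms
  by (intro abelian_subgroupI3 additive_subgroupI)

abbreviation cls :: "('a \<times> 's \<Rightarrow> 'f) \<Rightarrow> ('a \<times> 's \<Rightarrow> 'f) set" where
  "cls p \<equiv> N +>\<^bsub>M\<^esub> p"

lemma T_simps:
  "carrier T = cls ` carrier M"
  "X \<oplus>\<^bsub>T\<^esub> Y = X <+>\<^bsub>M\<^esub> Y"
  "\<zero>\<^bsub>T\<^esub> = N"
  "X \<otimes>\<^bsub>T\<^esub> Y = rcoset_mult M N X Y"
  "c \<odot>\<^bsub>T\<^esub> X = (\<Union>p\<in>X. cls (c \<odot>\<^bsub>M\<^esub> p))"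
  by (auto simp: tensor_algebra_def Let_def FactRing_def ring.defs A_RCOSETS_def')

lemma cls_closed [simp]: "p \<in> carrier M \<Longrightarrow> cls p \<in> carrier T"
  by (simp add: T_simps(1))

lemma cls_eqI:
  assumes "p \<in> carrier M" "q \<in> carrier M" "p \<ominus>\<^bsub>M\<^esub> q \<in> N"
  shows "cls p = cls q"
  using assms null.a_rcos_module_rev[of q p] null.a_repr_independence'[of p q]
  by (simp add: a_minus_def)

lemma cls_memD:
  assumes "p \<in> carrier M" "q \<in> cls p"
  shows "q \<in> carrier M" and "q \<ominus>\<^bsub>M\<^esub> p \<in> N"
  using assms null.a_rcos_module_imp[of p q] null.a_elemrcos_carrier[of p q]
  by (simp_all add: a_minus_def)

lemma cls_self: "p \<in> carrier M \<Longrightarrow> p \<in> cls p"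
  by (rule null.a_rcos_self)

lemma cls_add: "\<lbrakk>p \<in> carrier M; q \<in> carrier M\<rbrakk> \<Longrightarrow> cls p \<oplus>\<^bsub>T\<^esub> cls q = cls (p \<oplus>\<^bsub>M\<^esub> q)"
  by (simp add: T_simps(2) null.a_rcos_sum)

lemma cls_zero: "\<zero>\<^bsub>T\<^esub> = cls \<zero>\<^bsub>M\<^esub>"
  using M.a_coset_add_zero[OF null(1)] by (simp add: T_simps(3))

text \<open>The scalar multiple of a coset is by definition a union over all its representatives.
  Since \<open>N\<close> is closed under scalars, every representative contributes the same coset,
  and the union collapses to it.\<close>

lemma cls_smult:
  assumes c: "c \<in> carrier F" and p: "p \<in> carrier M"
  shows "c \<odot>\<^bsub>T\<^esub> cls p = cls (c \<odot>\<^bsub>M\<^esub> p)"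
proof -
  have "cls (c \<odot>\<^bsub>M\<^esub> q) = cls (c \<odot>\<^bsub>M\<^esub> p)" if q: "q \<in> cls p" for q
  proof (rule cls_eqI)
    note q' = cls_memD[OF p q]
    have "linear_map F M M (\<lambda>q. c \<odot>\<^bsub>M\<^esub> q)"
      using c by (auto simp: linear_map_def M.smult_r_distr M.smult_assoc1[symmetric] F.m_comm)
    from linear_map_minus[OF this module_M module_M q'(1) p]
    show "c \<odot>\<^bsub>M\<^esub> q \<ominus>\<^bsub>M\<^esub> c \<odot>\<^bsub>M\<^esub> p \<in> N" using null(4)[OF c q'(2)] by simp
  qed (use c p cls_memD(1)[OF p q] in auto)
  then show ?thesis unfolding T_simps(5) by (intro UN_constant_eq[OF cls_self[OF p]] ballI)
qed

text \<open>As for scalars, the defining union has equal members. Representatives are exchanged one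
  factor at a time: ab - pb = (a - p) b and pb - pq = p (b - q) both lie in the ideal
  \<open>N\<close>.\<close>

lemma cls_mult:
  assumes p: "p \<in> carrier M" and q: "q \<in> carrier M"
  shows "cls p \<otimes>\<^bsub>T\<^esub> cls q = cls (p \<otimes>\<^bsub>M\<^esub> q)"
proof -
  have "cls (a \<otimes>\<^bsub>M\<^esub> b) = cls (p \<otimes>\<^bsub>M\<^esub> q)" if a: "a \<in> cls p" and b: "b \<in> cls q" for a b
  proof -
    note a' = cls_memD[OF p a] and b' = cls_memD[OF q b]
    have "cls (a \<otimes>\<^bsub>M\<^esub> b) = cls (p \<otimes>\<^bsub>M\<^esub> b)"
      using linear_map_minus[OF M_mult_linear_left[OF b'(1)] module_M module_M a'(1) p]
        null_mult_right[OF a'(2) b'(1)] a'(1) b'(1) p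
      by (intro cls_eqI M_mult_closed) auto
    also have "\<dots> = cls (p \<otimes>\<^bsub>M\<^esub> q)"
      using linear_map_minus[OF M_mult_linear_right[OF p] module_M module_M b'(1) q]
        null_mult_left[OF b'(2) p] b'(1) p q
      by (intro cls_eqI M_mult_closed) auto
    finally show ?thesis .
  qed
  then show ?thesis
    unfolding T_simps(4) rcoset_mult_def
    by (intro UN_constant_eq[OF cls_self[OF p]] UN_constant_eq[OF cls_self[OF q]] ballI)
qed

lemma T_cases: "X \<in> carrier T \<Longrightarrow> (\<And>p. \<lbrakk>p \<in> carrier M; X = cls p\<rbrakk> \<Longrightarrow> thesis) \<Longrightarrow> thesis"
  by (auto simp: T_simps(1))

lemma module_T: "module F T"
proof (rule moduleI)
  show "abelian_group T"
  proof (rule abelian_groupI)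
    show "\<exists>Y\<in>carrier T. Y \<oplus>\<^bsub>T\<^esub> X = \<zero>\<^bsub>T\<^esub>" if X: "X \<in> carrier T" for X
    proof -
      obtain p where p: "p \<in> carrier M" "X = cls p" using X by (rule T_cases)
      then show ?thesis
        by (intro bexI[of _ "cls (\<ominus>\<^bsub>M\<^esub> p)"]) (auto simp: cls_add cls_zero M.M.l_neg)
    qed
  qed (auto elim!: T_cases simp: cls_add cls_zero M.M.a_ac)
qed (auto elim!: T_cases simp: F.is_cring cls_add cls_smult M.smult_l_distr M.smult_r_distr
  M.smult_assoc1)

text \<open>The map (a, s) \<mapsto> \<phi>(s) a is bilinear, so its linear extension to the free
  module kills the relators, hence all of \<open>N\<close>, and is constant on cosets.\<close>

lemma slice_map_exists:
  assumes phi: "linear_form F S \<phi>"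
  shows "\<exists>k. linear_map F T A k \<and>
    (\<forall>a\<in>carrier A. \<forall>s\<in>carrier S. k (cls (\<delta> a s)) = \<phi> s \<odot>\<^bsub>A\<^esub> a)"
proof -
  define e where "e u = \<phi> (snd u) \<odot>\<^bsub>A\<^esub> fst u" for u
  note phi' = linear_formD[OF phi]
  have e: "e \<in> carrier A \<times> carrier S \<rightarrow> carrier A" by (auto simp: e_def phi')
  define L where "L = linear_ext F A e"
  have L: "linear_map F M A L"
    unfolding L_def by (rule linear_ext_linear[OF A.module_axioms e])
  note L' = linear_mapD[OF L]
  have L_delta: "L (\<delta> a s) = \<phi> s \<odot>\<^bsub>A\<^esub> a" if "a \<in> carrier A" "s \<in> carrier S" for a s
    unfolding L_def using linear_ext_delta[OF A.module_axioms e that] by (simp add: e_def)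
  have L_null: "L n = \<zero>\<^bsub>A\<^esub>" if n: "n \<in> N" for n
  proof -
    have "L n \<in> {\<zero>\<^bsub>A\<^esub>}"
      by (rule linear_map_null[OF L A.module_axioms A.submodule_zero _ _ _ _ n])
        (auto simp: L_delta phi' A.smult_l_distr A.smult_r_distr A.smult_assoc1[symmetric]
          F.m_comm a_minus_def A.M.r_neg)
    then show ?thesis by simp
  qed
  have L_cls: "L q = L p" if p: "p \<in> carrier M" and q: "q \<in> cls p" for p q
  proof -
    note q' = cls_memD[OF p q]
    have "L q \<ominus>\<^bsub>A\<^esub> L p = \<zero>\<^bsub>A\<^esub>"
      using linear_map_minus[OF L module_M A.module_axioms q'(1) p] L_null[OF q'(2)] by simp
    then show ?thesis
      using A.M.minus_equality[of "L q" "\<ominus>\<^bsub>A\<^esub> L p"] L'(1)[OF p] L'(1)[OF q'(1)]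
      by (simp add: a_minus_def)
  qed
  \<comment> \<open>The chosen representative does not matter, since \<open>L\<close> is constant on
    each coset.\<close>
  define k where "k X = L (SOME p. p \<in> X)" for X
  have k: "k (cls p) = L p" if p: "p \<in> carrier M" for p
    unfolding k_def by (rule L_cls[OF p]) (rule someI[of _ p], rule cls_self[OF p])
  have "linear_map F T A k"
    unfolding linear_map_def by (auto elim!: T_cases simp: cls_add cls_smult k L')
  then show ?thesis using k L_delta by auto
qed

lemma tensor_product_tensor_algebra: "tensor_product F A S T (\<lambda>a s. cls (\<delta> a s))"
proof (intro tensor_product.intro tensor_product_axioms.intro)
  show "P X"
    if X: "X \<in> carrier T" and zero: "P \<zero>\<^bsub>T\<^esub>"
      and step: "\<And>Y a s. \<lbrakk>Y \<in> carrier T; a \<in> carrier A; s \<in> carrier S; P Y\<rbrakk>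
        \<Longrightarrow> P (Y \<oplus>\<^bsub>T\<^esub> cls (\<delta> a s))" for P X
  proof -
    obtain p where p: "p \<in> carrier M" "X = cls p" using X by (rule T_cases)
    have "P (cls p)"
      using p(1)
    proof (rule M_induct)
      show "P (cls \<zero>\<^bsub>M\<^esub>)" using zero by (simp add: cls_zero)
      fix q c x r
      assume *: "q \<in> carrier M" "c \<in> carrier F" "x \<in> carrier A" "r \<in> carrier S" "P (cls q)"
      \<comment> \<open>The scalar moves into the left factor through a relator, so a scaled basis
        vector contributes a single pure tensor, as the induction principle demands.\<close>
      have "cls (q \<oplus>\<^bsub>M\<^esub> c \<odot>\<^bsub>M\<^esub> \<delta> x r) = cls q \<oplus>\<^bsub>T\<^esub> cls (\<delta> (c \<odot>\<^bsub>A\<^esub> x) r)"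
        using * cls_eqI[OF _ _ relators_null(3)[of x r c]] by (simp add: cls_add)
      then show "P (cls (q \<oplus>\<^bsub>M\<^esub> c \<odot>\<^bsub>M\<^esub> \<delta> x r))" using * step by simp
    qed
    then show ?thesis using p by simp
  qed
  fix a r assume a: "a \<in> carrier A" and r: "r \<in> carrier S"
  show "cls (\<delta> (a \<oplus>\<^bsub>A\<^esub> b) r) = cls (\<delta> a r) \<oplus>\<^bsub>T\<^esub> cls (\<delta> b r)" if "b \<in> carrier A" for b
    using a r that cls_eqI[OF _ _ relators_null(1)[OF a r that]] by (simp add: cls_add)
  show "cls (\<delta> a (r \<oplus>\<^bsub>S\<^esub> s)) = cls (\<delta> a r) \<oplus>\<^bsub>T\<^esub> cls (\<delta> a s)" if "s \<in> carrier S" for s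
    using a r that cls_eqI[OF _ _ relators_null(2)[OF a r that]] by (simp add: cls_add)
  fix c assume c: "c \<in> carrier F"
  show "cls (\<delta> (c \<odot>\<^bsub>A\<^esub> a) r) = c \<odot>\<^bsub>T\<^esub> cls (\<delta> a r)"
    using a r c cls_eqI[OF _ _ relators_null(3)[OF a r c]] by (simp add: cls_smult)
  show "cls (\<delta> a (c \<odot>\<^bsub>S\<^esub> r)) = c \<odot>\<^bsub>T\<^esub> cls (\<delta> a r)"
    using a r c cls_eqI[OF _ _ relators_null(4)[OF a r c]] by (simp add: cls_smult)
qed (use slice_map_exists in \<open>auto elim!: T_cases simp: F.field_axioms A.assoc_algebra_axioms
  S.comm_assoc_algebra_axioms module_T cls_add cls_mult M_mult_closed M_mult_delta
  linear_mapD(2)[OF M_mult_linear_left] linear_mapD(2)[OF M_mult_linear_right]\<close>)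

end

theorem theorem3p1:
  fixes F :: "('f, 'm) ring_scheme"
    and A :: "('f, 'a, 'u) module_scheme"
    and S :: "('f, 's, 'v) module_scheme"
  assumes "field F"
    and "ring_characteristic F \<noteq> 2"
    and "assoc_algebra F A"
    and "comm_assoc_algebra F S"
    and "jordan_left_gh_derivations_are_left F A"
  shows "jordan_left_gh_derivations_are_left F (tensor_algebra F A S)"
proof -
  have "algebra_pair F A S" using assms by (intro algebra_pair.intro)
  then have "tensor_product F A S (tensor_algebra F A S)
      (\<lambda>a s. tensor_null F A S +>\<^bsub>free_pair_algebra F A S\<^esub> pair_delta F a s)"
    by (rule algebra_pair.tensor_product_tensor_algebra)
  then show ?thesis
    using assms(5) by (rule tensor_product.jordan_left_gh_derivations_are_left_tensor)
qed

end
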